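(* Let $M$ be a closed Riemannian manifold with Ricci curvature bounded from below by $-K$. Let $T>0$, let $p>1$, let $\lambda=\lambda(t)$ be a function of $t$, and let $u>0$ be a smooth solution on $M\times[0,T)$ of the heat equation $$(\partial_t-\Delta)u=\lambda(t)u-u^p.$$ Let $a>1$, $w=\log u$, and $$F=t\big(|\nabla w|^2-a\,w_t+a(\lambda-u^{p-1})\big).$$ Then there is a constant $C=C(u^{p-1},K,a,p,T)$ such that $$\sup_{M\times[0,T)}F\le C(u^{p-1},K,a,p,T).$$
   Context: $\nabla$ and $\Delta$ are the gradient and the Laplace–Beltrami operator on $M$. The Ricci lower bound means $\mathrm{Ric}(X,X)\ge -K|X|^2$ for all tangent vectors $X$. The notation $C(u^{p-1},K,a,p,T)$ means a constant depending only on (an upper bound over $M\times[0,T)$ for) the function $u^{p-1}$ and on $K$, $a$, $p$, $T$; the manifold $M$ (hence its dimension) is fixed. *)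

theory Defs
  imports "HOL-Analysis.Analysis"
begin

text \<open>Smooth maps between normed spaces.\<close>

primrec higher_differentiable_on ::
    "nat \<Rightarrow> 'a::real_normed_vector set \<Rightarrow> ('a \<Rightarrow> 'b::real_normed_vector) \<Rightarrow> bool" where
  "higher_differentiable_on 0 S f \<longleftrightarrow> continuous_on S f"
| "higher_differentiable_on (Suc n) S f \<longleftrightarrow>
     (\<forall>x\<in>S. f differentiable (at x)) \<and>
     (\<forall>v. higher_differentiable_on n S (\<lambda>x. frechet_derivative f (at x) v))"

text \<open>On an arbitrary set, smoothness means existence of local smooth extensions; for open sets
  this is ordinary smoothness.  It is used on sets of the form \<open>V \<times> [0,T)\<close> with \<open>V\<close> open.\<close>

definition smooth_on ::
    "'a::real_normed_vector set \<Rightarrow> ('a \<Rightarrow> 'b::real_normed_vector) \<Rightarrow> bool" where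
  "smooth_on S f \<longleftrightarrow>
     (\<forall>x\<in>S. \<exists>W h. open W \<and> x \<in> W \<and> (\<forall>n. higher_differentiable_on n W h) \<and>
                   (\<forall>y \<in> W \<inter> S. h y = f y))"

text \<open>Riemannian geometry in coordinates: \<open>G y\<close> is the matrix \<open>(g\<^sub>i\<^sub>j)\<close> of the metric at the
  coordinate point \<open>y\<close>, and vectors at \<open>y\<close> are identified with their components.\<close>

definition pderiv_at :: "'n::finite \<Rightarrow> (real^'n \<Rightarrow> real) \<Rightarrow> real^'n \<Rightarrow> real" where
  "pderiv_at i f y = frechet_derivative f (at y) (axis i 1)"

definition metric_inner ::
    "(real^'n \<Rightarrow> real^'n^'n) \<Rightarrow> real^'n \<Rightarrow> real^'n \<Rightarrow> real^'n::finite \<Rightarrow> real" where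
  "metric_inner G y v w = v \<bullet> (G y *v w)"

text \<open>\<open>christoffel G k i j\<close> is the symbol \<open>\<Gamma>\<close> of the Levi-Civita connection with upper
  index \<open>k\<close> and lower indices \<open>i, j\<close>.\<close>

definition christoffel ::
    "(real^'n \<Rightarrow> real^'n^'n) \<Rightarrow> 'n \<Rightarrow> 'n \<Rightarrow> 'n::finite \<Rightarrow> real^'n \<Rightarrow> real" where
  "christoffel G k i j y =
     (\<Sum>l\<in>UNIV. matrix_inv (G y) $ k $ l *
        (pderiv_at i (\<lambda>z. G z $ j $ l) y + pderiv_at j (\<lambda>z. G z $ i $ l) y
           - pderiv_at l (\<lambda>z. G z $ i $ j) y)) / 2"

text \<open>\<open>riemann G l k i j\<close> is the \<open>l\<close>-th component of
  \<open>R(\<partial>\<^sub>i, \<partial>\<^sub>j) \<partial>\<^sub>k = \<nabla>\<^sub>i \<nabla>\<^sub>j \<partial>\<^sub>k - \<nabla>\<^sub>j \<nabla>\<^sub>i \<partial>\<^sub>k\<close>, and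
  \<open>Ric(Y, Z)\<close> is the trace of \<open>X \<mapsto> R(X, Y) Z\<close> (round spheres have positive Ricci curvature).\<close>

definition riemann ::
    "(real^'n \<Rightarrow> real^'n^'n) \<Rightarrow> 'n \<Rightarrow> 'n \<Rightarrow> 'n \<Rightarrow> 'n::finite \<Rightarrow> real^'n \<Rightarrow> real" where
  "riemann G l k i j y =
     pderiv_at i (christoffel G l j k) y - pderiv_at j (christoffel G l i k) y
     + (\<Sum>m\<in>UNIV. christoffel G l i m y * christoffel G m j k y
                   - christoffel G l j m y * christoffel G m i k y)"

definition ricci ::
    "(real^'n \<Rightarrow> real^'n^'n) \<Rightarrow> real^'n \<Rightarrow> real^'n \<Rightarrow> real^'n::finite \<Rightarrow> real" where
  "ricci G y v w =
     (\<Sum>j\<in>UNIV. \<Sum>k\<in>UNIV. (\<Sum>i\<in>UNIV. riemann G i k i j y) * v $ j * w $ k)"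

definition grad ::
    "(real^'n \<Rightarrow> real^'n^'n) \<Rightarrow> (real^'n \<Rightarrow> real) \<Rightarrow> real^'n \<Rightarrow> real^'n::finite" where
  "grad G f y = matrix_inv (G y) *v (\<chi> i. pderiv_at i f y)"

text \<open>The divergence of a vector field \<open>X\<close> is the trace of its covariant derivative \<open>\<nabla>X\<close>.\<close>

definition divergence ::
    "(real^'n \<Rightarrow> real^'n^'n) \<Rightarrow> (real^'n \<Rightarrow> real^'n) \<Rightarrow> real^'n::finite \<Rightarrow> real" where
  "divergence G X y =
     (\<Sum>i\<in>UNIV. pderiv_at i (\<lambda>z. X z $ i) y + (\<Sum>j\<in>UNIV. christoffel G i i j y * X y $ j))"

definition laplace_coord ::
    "(real^'n \<Rightarrow> real^'n^'n) \<Rightarrow> (real^'n \<Rightarrow> real) \<Rightarrow> real^'n::finite \<Rightarrow> real" where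
  "laplace_coord G f = divergence G (grad G f)"

text \<open>A chart is a pair of its domain and its coordinate map.  The manifold is the whole type
  \<open>'m\<close>, its dimension is \<open>CARD('n)\<close>.\<close>

type_synonym ('m, 'n) chart = "'m set \<times> ('m \<Rightarrow> real^'n)"

abbreviation chart_inv :: "('m, 'n::finite) chart \<Rightarrow> real^'n \<Rightarrow> 'm" where
  "chart_inv c \<equiv> inv_into (fst c) (snd c)"

locale smooth_atlas =
  fixes A :: "('m::{t2_space,second_countable_topology}, 'n::finite) chart set"
  assumes atlas_covers: "(\<Union>c\<in>A. fst c) = UNIV"
    and open_domain: "c \<in> A \<Longrightarrow> open (fst c)"
    and open_range: "c \<in> A \<Longrightarrow> open (snd c ` fst c)"
    and chart_homeomorphism:
      "c \<in> A \<Longrightarrow> homeomorphism (fst c) (snd c ` fst c) (snd c) (chart_inv c)"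
    and smooth_transition:
      "c \<in> A \<Longrightarrow> d \<in> A \<Longrightarrow> smooth_on (snd c ` (fst c \<inter> fst d)) (snd d \<circ> chart_inv c)"

text \<open>A Riemannian metric is given by its component matrices \<open>g c y\<close> in each chart \<open>c\<close>
  (\<open>y\<close> in the range of \<open>c\<close>), related by the transformation law of a covariant 2-tensor.\<close>

locale riemannian_manifold = smooth_atlas A
  for A :: "('m::{t2_space,second_countable_topology}, 'n::finite) chart set" +
  fixes g :: "('m, 'n) chart \<Rightarrow> real^'n \<Rightarrow> real^'n^'n"
  assumes metric_smooth: "c \<in> A \<Longrightarrow> smooth_on (snd c ` fst c) (g c)"
    and metric_symmetric: "c \<in> A \<Longrightarrow> y \<in> snd c ` fst c \<Longrightarrow> transpose (g c y) = g c y"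
    and metric_positive:
      "c \<in> A \<Longrightarrow> y \<in> snd c ` fst c \<Longrightarrow> v \<noteq> 0 \<Longrightarrow> metric_inner (g c) y v v > 0"
    and metric_transform:
      "c \<in> A \<Longrightarrow> d \<in> A \<Longrightarrow> x \<in> fst c \<inter> fst d \<Longrightarrow>
        metric_inner (g c) (snd c x) v w =
        metric_inner (g d) (snd d x)
          (frechet_derivative (snd d \<circ> chart_inv c) (at (snd c x)) v)
          (frechet_derivative (snd d \<circ> chart_inv c) (at (snd c x)) w)"

locale closed_riemannian_manifold = riemannian_manifold A g
  for A :: "('m::{t2_space,second_countable_topology}, 'n::finite) chart set"
    and g :: "('m, 'n) chart \<Rightarrow> real^'n \<Rightarrow> real^'n^'n" +
  assumes compact_manifold: "compact (UNIV :: 'm set)"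

definition ricci_bounded_below ::
    "('m, 'n::finite) chart set \<Rightarrow> (('m, 'n) chart \<Rightarrow> real^'n \<Rightarrow> real^'n^'n) \<Rightarrow> real \<Rightarrow> bool" where
  "ricci_bounded_below A g k \<longleftrightarrow>
     (\<forall>c\<in>A. \<forall>x\<in>fst c. \<forall>v. ricci (g c) (snd c x) v v \<ge> k * metric_inner (g c) (snd c x) v v)"

text \<open>The scalars below do not depend on the chart around \<open>x\<close> in which they are computed, so
  an arbitrary one is used.\<close>

definition chart_at :: "('m, 'n::finite) chart set \<Rightarrow> 'm \<Rightarrow> ('m, 'n) chart" where
  "chart_at A x = (SOME c. c \<in> A \<and> x \<in> fst c)"

definition grad_norm_sq ::
    "('m, 'n::finite) chart set \<Rightarrow> (('m, 'n) chart \<Rightarrow> real^'n \<Rightarrow> real^'n^'n)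
      \<Rightarrow> ('m \<Rightarrow> real) \<Rightarrow> 'm \<Rightarrow> real" where
  "grad_norm_sq A g f x =
     (let c = chart_at A x; X = grad (g c) (f \<circ> chart_inv c) (snd c x)
      in metric_inner (g c) (snd c x) X X)"

definition laplace_beltrami ::
    "('m, 'n::finite) chart set \<Rightarrow> (('m, 'n) chart \<Rightarrow> real^'n \<Rightarrow> real^'n^'n)
      \<Rightarrow> ('m \<Rightarrow> real) \<Rightarrow> 'm \<Rightarrow> real" where
  "laplace_beltrami A g f x =
     (let c = chart_at A x in laplace_coord (g c) (f \<circ> chart_inv c) (snd c x))"

definition smooth_spacetime ::
    "('m, 'n::finite) chart set \<Rightarrow> real \<Rightarrow> ('m \<Rightarrow> real \<Rightarrow> real) \<Rightarrow> bool" where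
  "smooth_spacetime A T u \<longleftrightarrow>
     (\<forall>c\<in>A. smooth_on (snd c ` fst c \<times> {0..<T}) (\<lambda>(y, t). u (chart_inv c y) t))"

text \<open>The derivative in \<open>t\<close> on \<open>[0,T)\<close>, one-sided at \<open>t = 0\<close>.\<close>

definition time_deriv :: "real \<Rightarrow> ('m \<Rightarrow> real \<Rightarrow> real) \<Rightarrow> 'm \<Rightarrow> real \<Rightarrow> real" where
  "time_deriv T u x t = vector_derivative (u x) (at t within {0..<T})"

definition heat_solution ::
    "('m, 'n::finite) chart set \<Rightarrow> (('m, 'n) chart \<Rightarrow> real^'n \<Rightarrow> real^'n^'n)
      \<Rightarrow> real \<Rightarrow> real \<Rightarrow> (real \<Rightarrow> real) \<Rightarrow> ('m \<Rightarrow> real \<Rightarrow> real) \<Rightarrow> bool" where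
  "heat_solution A g T p lam u \<longleftrightarrow>
     smooth_spacetime A T u \<and>
     (\<forall>x. \<forall>t\<in>{0..<T}. u x t > 0) \<and>
     (\<forall>x. \<forall>t\<in>{0..<T}.
        time_deriv T u x t - laplace_beltrami A g (\<lambda>z. u z t) x
          = lam t * u x t - u x t powr p)"

definition harnack_quantity ::
    "('m, 'n::finite) chart set \<Rightarrow> (('m, 'n) chart \<Rightarrow> real^'n \<Rightarrow> real^'n^'n)
      \<Rightarrow> real \<Rightarrow> real \<Rightarrow> real \<Rightarrow> (real \<Rightarrow> real) \<Rightarrow> ('m \<Rightarrow> real \<Rightarrow> real)
      \<Rightarrow> 'm \<Rightarrow> real \<Rightarrow> real" where
  "harnack_quantity A g T a p lam u x t =
     (let w = (\<lambda>z s. ln (u z s))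
      in t * (grad_norm_sq A g (\<lambda>z. w z t) x - a * time_deriv T w x t
                + a * (lam t - u x t powr (p - 1))))"

end

theory Submission
  imports Defs
begin

text \<open>Li-Yau argument. With \<open>w = log u\<close> the equation reads
  \<open>w\<^sub>t = \<Delta>w + |\<nabla>w|\<^sup>2 + \<lambda> - v\<close>, \<open>v = u\<^sup>p\<^sup>-\<^sup>1\<close>, hence \<open>F = t Q\<close> with \<open>Q = - a \<Delta>w - (a - 1) |\<nabla>w|\<^sup>2\<close>,
  and \<open>\<lambda>\<close>, being constant in space, disappears from all further computations. The Bochner formula gives
  \<open>(\<partial>\<^sub>t - \<Delta> - 2 \<nabla>w \<cdot> \<nabla>) Q = - 2 |\<nabla>\<^sup>2 w|\<^sup>2 - 2 Ric(\<nabla>w, \<nabla>w) - (p - 1) v Q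
  + (a (p - 1)\<^sup>2 + (a - 1) (p - 1)) v |\<nabla>w|\<^sup>2\<close>.
  At a positive maximum of \<open>F\<close>, where \<open>n |\<nabla>\<^sup>2 w|\<^sup>2 \<ge> (\<Delta>w)\<^sup>2 \<ge> (Q\<^sup>2 + (a - 1)\<^sup>2 |\<nabla>w|\<^sup>4) / a\<^sup>2\<close>, the quartic
  term absorbs the terms linear in \<open>|\<nabla>w|\<^sup>2\<close> and a quadratic inequality for \<open>F\<close> remains.

  In coordinates, the Bochner formula is obtained for \<open>N = \<nabla>X\<close>, \<open>X = \<nabla>w\<close>, from \<open>\<nabla>|X|\<^sup>2 = 2 N X\<close> and
  the contracted Ricci identity \<open>div (N X) = X (div X) + Ric(X, X) + tr N\<^sup>2\<close>, so that no normal
  coordinates are needed.\<close>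

subsection \<open>Smooth functions on open sets\<close>

text \<open>Two obstacles shape the development. \<open>laplace_beltrami\<close> and
  \<open>grad_norm_sq\<close> are computed in a chart picked separately at each point, whereas the
  maximum principle differentiates in one chart around the maximum; hence the behaviour of gradient
  and Hessian under a change of charts has to be settled. Moreover \<open>u\<close> lives on a
  half-open time interval, while the chart domains in space-time are open only for 0 < t < T. The
  function that is maximised is therefore (t - e) Q on the compact slab from time e to time t, and e
  tends to 0 only at the end, for each point separately. The constant arises as follows. Put N = n
  a^2 / 2 and D = 2 |K| + (a (p-1)^2 + (a-1) (p-1)) B, where B bounds v. With y = |\<nabla>w|^2, the
  largest value of D y - (a-1)^2 y^2 / N is E = N D^2 / (4 (a-1)^2), and the quadratic inequality
  F^2 \<le> N F + N T^2 E gives F \<le> N + T^2 E.\<close>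

text \<open>Names the expression in the recursion of \<open>higher_differentiable_on\<close>, so
  that derivatives of every order are iterates of one operator on functions. Where \<open>f\<close>
  is not differentiable its value is unspecified.\<close>

definition ddir :: "'a::real_normed_vector \<Rightarrow> ('a \<Rightarrow> 'b::real_normed_vector) \<Rightarrow> 'a \<Rightarrow> 'b" where
  "ddir v f = (\<lambda>x. frechet_derivative f (at x) v)"

lemma has_derivative_ddir:
  "f differentiable (at x) \<Longrightarrow> (f has_derivative (\<lambda>v. ddir v f x)) (at x)"
  by (simp add: ddir_def frechet_derivative_works)

lemma ddir_eq: "(f has_derivative f') (at x) \<Longrightarrow> ddir v f x = f' v"
  unfolding ddir_def using frechet_derivative_at by metis

lemma differentiable_cong_open:
  assumes "open S" "x \<in> S" "\<And>y. y \<in> S \<Longrightarrow> f y = g y" "f differentiable (at x)"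
  shows "g differentiable (at x)"
  using assms(4) has_derivative_transform_within_open[OF _ assms(1,2)] assms(3)
  unfolding differentiable_def by metis

text \<open>Holds even where \<open>f\<close> is not differentiable: both functions have the same
  candidate derivatives, so the choice operator picks the same one.\<close>

lemma frechet_cong_open:
  assumes "open S" "x \<in> S" "\<And>y. y \<in> S \<Longrightarrow> f y = g y"
  shows "frechet_derivative f (at x) = frechet_derivative g (at x)"
proof -
  have "(f has_derivative h) (at x) \<longleftrightarrow> (g has_derivative h) (at x)" for h
    using has_derivative_transform_within_open[OF _ assms(1,2)] assms(3) by (metis (mono_tags))
  then show ?thesis unfolding frechet_derivative_def by simp
qed

lemma ddir_cong_open:
  assumes "open S" "x \<in> S" "\<And>y. y \<in> S \<Longrightarrow> f y = g y"
  shows "ddir v f x = ddir v g x"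
  unfolding ddir_def using frechet_cong_open[OF assms] by simp

lemma hdo_Suc:
  "higher_differentiable_on (Suc n) S f \<longleftrightarrow>
     (\<forall>x\<in>S. f differentiable (at x)) \<and> (\<forall>v. higher_differentiable_on n S (ddir v f))"
  by (simp add: ddir_def)

declare higher_differentiable_on.simps(2)[simp del]

lemma hdo_cong:
  assumes "open S" "\<And>x. x \<in> S \<Longrightarrow> f x = g x" "higher_differentiable_on n S f"
  shows "higher_differentiable_on n S g"
  using assms(2,3)
proof (induction n arbitrary: f g)
  case 0 then show ?case using continuous_on_cong[of S S f g] by auto
next
  case (Suc n)
  have "higher_differentiable_on n S (ddir v g)" for v
    using Suc.IH[of "ddir v f" "ddir v g"] ddir_cong_open[OF assms(1)] Suc.prems
    by (metis hdo_Suc)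
  then show ?case
    using Suc.prems differentiable_cong_open[OF assms(1)] by (metis hdo_Suc)
qed

lemma hdo_subset: "T \<subseteq> S \<Longrightarrow> higher_differentiable_on n S f \<Longrightarrow> higher_differentiable_on n T f"
  by (induction n arbitrary: f) (auto simp: hdo_Suc intro: continuous_on_subset)

lemma hdo_SucD: "higher_differentiable_on (Suc n) S f \<Longrightarrow> higher_differentiable_on n S f"
proof (induction n arbitrary: f)
  case 0 then show ?case
    by (auto simp: hdo_Suc intro!: continuous_at_imp_continuous_on differentiable_imp_continuous_within)
next
  case (Suc n) then show ?case by (metis hdo_Suc)
qed

lemma hdo_local:
  assumes "\<And>x. x \<in> S \<Longrightarrow> \<exists>W. open W \<and> x \<in> W \<and> higher_differentiable_on n W f"
  shows "higher_differentiable_on n S f"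
  using assms
proof (induction n arbitrary: f)
  case 0
  then show ?case
    by (metis continuous_at_imp_continuous_on continuous_on_eq_continuous_at higher_differentiable_on.simps(1))
next
  case (Suc n)
  then show ?case unfolding hdo_Suc by (metis (no_types, lifting))
qed

text \<open>Openness is carried along because a derivative \<open>at x\<close> is determined by the
  values on a neighbourhood; the congruence arguments in the inductions below rely on it.\<close>

definition csmooth :: "'a::real_normed_vector set \<Rightarrow> ('a \<Rightarrow> 'b::real_normed_vector) \<Rightarrow> bool" where
  "csmooth S f \<longleftrightarrow> open S \<and> (\<forall>n. higher_differentiable_on n S f)"

lemma csmooth_open: "csmooth S f \<Longrightarrow> open S"
  by (simp add: csmooth_def)

text \<open>The local extension in \<open>smooth_on\<close> agrees with \<open>f\<close> on an open
  set around the point inside the smaller set, so all derivatives coincide there. For solutions this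
  is the passage from [0,T) to (0,T).\<close>

lemma smooth_on_imp_csmooth:
  assumes "smooth_on S f" "T \<subseteq> S" "open T"
  shows "csmooth T f"
  unfolding csmooth_def
proof (intro conjI allI hdo_local)
  fix n x assume "x \<in> T"
  then obtain W h where W: "open W" "x \<in> W" "\<And>n. higher_differentiable_on n W h"
      "\<forall>y\<in>W \<inter> S. h y = f y"
    using assms unfolding smooth_on_def by (meson subsetD)
  have "higher_differentiable_on n (W \<inter> T) f"
    by (rule hdo_cong[of _ h]) (use W assms in \<open>auto intro: hdo_subset[OF _ W(3)]\<close>)
  then show "\<exists>W. open W \<and> x \<in> W \<and> higher_differentiable_on n W f"
    using W \<open>x \<in> T\<close> assms by (intro exI[of _ "W \<inter> T"]) auto
qed (rule assms)

lemma csmooth_subset: "csmooth S f \<Longrightarrow> T \<subseteq> S \<Longrightarrow> open T \<Longrightarrow> csmooth T f"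
  by (auto simp: csmooth_def intro: hdo_subset)

lemma csmooth_cong: "csmooth S f \<Longrightarrow> (\<And>x. x \<in> S \<Longrightarrow> f x = g x) \<Longrightarrow> csmooth S g"
  using hdo_cong unfolding csmooth_def by blast

lemma csmooth_differentiable: "csmooth S f \<Longrightarrow> x \<in> S \<Longrightarrow> f differentiable (at x)"
  unfolding csmooth_def using hdo_Suc by blast

lemma csmooth_ddir: "csmooth S f \<Longrightarrow> csmooth S (ddir v f)"
  unfolding csmooth_def using hdo_Suc by blast

lemma csmooth_continuous: "csmooth S f \<Longrightarrow> continuous_on S f"
  unfolding csmooth_def by (metis higher_differentiable_on.simps(1))

lemma csmooth_has_derivative:
  "csmooth S f \<Longrightarrow> x \<in> S \<Longrightarrow> (f has_derivative (\<lambda>v. ddir v f x)) (at x)"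
  by (intro has_derivative_ddir csmooth_differentiable)

section \<open>Closure of smoothness under algebraic operations, elementary functions and affine
  substitutions\<close>

lemma ddir_const [simp]: "ddir v (\<lambda>_. c) = (\<lambda>_. 0)"
  by (rule ext, rule ddir_eq, rule has_derivative_const)

lemma hdo_const: "higher_differentiable_on n S (\<lambda>_. c)"
  by (induction n arbitrary: c) (auto simp: hdo_Suc)

lemma csmooth_const: "open S \<Longrightarrow> csmooth S (\<lambda>_. c)"
  by (simp add: csmooth_def hdo_const)

lemma ddir_bounded_linear:
  "bounded_linear L \<Longrightarrow> f differentiable (at x) \<Longrightarrow> ddir v (\<lambda>y. L (f y)) x = L (ddir v f x)"
  by (rule ddir_eq) (rule bounded_linear.has_derivative[OF _ has_derivative_ddir])

lemma csmooth_bounded_linear: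
  assumes L: "bounded_linear L" and f: "csmooth S f"
  shows "csmooth S (\<lambda>x. L (f x))"
proof -
  have o: "open S" using f csmooth_open by blast
  have "higher_differentiable_on n S (\<lambda>x. L (f x))" for n
    using f
  proof (induction n arbitrary: f)
    case 0 then show ?case
      using bounded_linear.continuous_on[OF L] csmooth_continuous by auto
  next
    case (Suc n)
    have "higher_differentiable_on n S (ddir v (\<lambda>x. L (f x)))" for v
      by (rule hdo_cong[OF o _ Suc.IH[OF csmooth_ddir[OF Suc.prems, of v]]])
         (simp add: ddir_bounded_linear[OF L] csmooth_differentiable[OF Suc.prems])
    then show ?case unfolding hdo_Suc
      using csmooth_has_derivative[OF Suc.prems] bounded_linear.has_derivative[OF L]
      unfolding differentiable_def by blast
  qed
  then show ?thesis using o by (simp add: csmooth_def)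
qed

lemma ddir_add:
  "f differentiable (at x) \<Longrightarrow> g differentiable (at x) \<Longrightarrow>
    ddir v (\<lambda>y. f y + g y) x = ddir v f x + ddir v g x"
  by (rule ddir_eq) (intro has_derivative_add has_derivative_ddir)

lemma ddir_mult:
  fixes f g :: "'a::real_normed_vector \<Rightarrow> real"
  shows "f differentiable (at x) \<Longrightarrow> g differentiable (at x) \<Longrightarrow>
    ddir v (\<lambda>y. f y * g y) x = ddir v f x * g x + f x * ddir v g x"
  by (subst ddir_eq[OF has_derivative_mult[OF has_derivative_ddir has_derivative_ddir]]) auto

lemma ddir_chain:
  fixes f :: "'a::real_normed_vector \<Rightarrow> real" and h :: "real \<Rightarrow> real"
  assumes "f differentiable (at x)" "(h has_real_derivative d) (at (f x))"
  shows "ddir v (\<lambda>y. h (f y)) x = d * ddir v f x" and "(\<lambda>y. h (f y)) differentiable (at x)"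
proof -
  have "((\<lambda>y. h (f y)) has_derivative (\<lambda>v. d * ddir v f x)) (at x)"
    using has_derivative_compose[OF has_derivative_ddir[OF assms(1)] assms(2)[unfolded has_field_derivative_def]] .
  then show "ddir v (\<lambda>y. h (f y)) x = d * ddir v f x" "(\<lambda>y. h (f y)) differentiable (at x)"
    by (auto simp: ddir_eq differentiable_def)
qed

lemma hdo_add:
  assumes o: "open S" and "higher_differentiable_on n S f" "higher_differentiable_on n S g"
  shows "higher_differentiable_on n S (\<lambda>x. f x + g x)"
  using assms(2,3)
proof (induction n arbitrary: f g)
  case 0 then show ?case by (auto intro: continuous_on_add)
next
  case (Suc n)
  have "higher_differentiable_on n S (ddir v (\<lambda>x. f x + g x))" for v
    by (rule hdo_cong[OF o _ Suc.IH[of "ddir v f" "ddir v g"]])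
       (use Suc.prems in \<open>auto simp: hdo_Suc ddir_add\<close>)
  then show ?case using Suc.prems unfolding hdo_Suc by (auto intro: differentiable_add)
qed

text \<open>The product rule leaves undifferentiated factors, for which \<open>hdo_SucD\<close>
  supplies one order less; hence the induction with both functions arbitrary.\<close>

lemma hdo_mult:
  fixes f g :: "'a::real_normed_vector \<Rightarrow> real"
  assumes o: "open S" and "higher_differentiable_on n S f" "higher_differentiable_on n S g"
  shows "higher_differentiable_on n S (\<lambda>x. f x * g x)"
  using assms(2,3)
proof (induction n arbitrary: f g)
  case 0 then show ?case by (auto intro: continuous_on_mult)
next
  case (Suc n)
  have "higher_differentiable_on n S (ddir v (\<lambda>x. f x * g x))" for v
    by (rule hdo_cong[OF o _ hdo_add[OF o Suc.IH[of "ddir v f" g] Suc.IH[of f "ddir v g"]]])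
       (use Suc.prems hdo_SucD[OF Suc.prems(1)] hdo_SucD[OF Suc.prems(2)]
          in \<open>auto simp: hdo_Suc ddir_mult\<close>)
  then show ?case using Suc.prems unfolding hdo_Suc by auto
qed

lemma csmooth_add: "csmooth S f \<Longrightarrow> csmooth S g \<Longrightarrow> csmooth S (\<lambda>x. f x + g x)"
  by (simp add: csmooth_def hdo_add)

lemma csmooth_mult:
  fixes f g :: "'a::real_normed_vector \<Rightarrow> real"
  shows "csmooth S f \<Longrightarrow> csmooth S g \<Longrightarrow> csmooth S (\<lambda>x. f x * g x)"
  by (simp add: csmooth_def hdo_mult)

lemma csmooth_cmult:
  fixes f :: "'a::real_normed_vector \<Rightarrow> real"
  shows "csmooth S f \<Longrightarrow> csmooth S (\<lambda>x. c * f x)"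
  by (intro csmooth_mult csmooth_const csmooth_open)

lemma csmooth_minus:
  fixes f :: "'a::real_normed_vector \<Rightarrow> real"
  shows "csmooth S f \<Longrightarrow> csmooth S (\<lambda>x. - f x)"
  using csmooth_cmult[of S f "-1"] by simp

lemma csmooth_diff:
  fixes f :: "'a::real_normed_vector \<Rightarrow> real"
  shows "csmooth S f \<Longrightarrow> csmooth S g \<Longrightarrow> csmooth S (\<lambda>x. f x - g x)"
  using csmooth_add[of S f "\<lambda>x. - g x"] csmooth_minus by auto

lemma csmooth_sum:
  assumes "open S" "\<And>i. i \<in> I \<Longrightarrow> csmooth S (f i)"
  shows "csmooth S (\<lambda>x. \<Sum>i\<in>I. f i x)"
  using assms(2) by (induction I rule: infinite_finite_induct) (auto intro: csmooth_const[OF assms(1)] csmooth_add)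

lemma csmooth_prod:
  fixes f :: "'i \<Rightarrow> 'a::real_normed_vector \<Rightarrow> real"
  assumes "open S" "\<And>i. i \<in> I \<Longrightarrow> csmooth S (f i)"
  shows "csmooth S (\<lambda>x. \<Prod>i\<in>I. f i x)"
  using assms(2) by (induction I rule: infinite_finite_induct) (auto intro: csmooth_const[OF assms(1)] csmooth_mult)

lemma ddir_sum:
  assumes "open S" "x \<in> S" "\<And>j. j \<in> I \<Longrightarrow> csmooth S (f j)"
  shows "ddir v (\<lambda>z. \<Sum>j\<in>I. f j z) x = (\<Sum>j\<in>I. ddir v (f j) x)"
  using assms(3)
proof (induction I rule: infinite_finite_induct)
  case (insert a I)
  then show ?case
    using ddir_add[OF csmooth_differentiable[OF insert.prems[of a] assms(2)]
      csmooth_differentiable[OF csmooth_sum[OF assms(1), of I f] assms(2)], of v] by simp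
qed auto

lemma ddir_mult_csmooth:
  fixes f h :: "'a::real_normed_vector \<Rightarrow> real"
  shows "csmooth S f \<Longrightarrow> csmooth S h \<Longrightarrow> x \<in> S \<Longrightarrow>
    ddir v (\<lambda>z. f z * h z) x = ddir v f x * h x + f x * ddir v h x"
  by (intro ddir_mult csmooth_differentiable)

text \<open>The derivative of the composite is the composite itself times a derivative of
  \<open>f\<close>, so the induction hypothesis is applied to the same function and only the order
  drops.\<close>

lemma csmooth_exp:
  fixes f :: "'a::real_normed_vector \<Rightarrow> real"
  assumes f: "csmooth S f"
  shows "csmooth S (\<lambda>x. exp (f x))"
proof -
  note o = csmooth_open[OF f]
  have "higher_differentiable_on n S (\<lambda>x. exp (f x))" for n
  proof (induction n)
    case 0 then show ?case using csmooth_continuous[OF f] by (auto intro: continuous_intros)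
  next
    case (Suc n)
    have "higher_differentiable_on n S (ddir v (\<lambda>x. exp (f x)))" for v
      by (rule hdo_cong[OF o _ hdo_mult[OF o Suc.IH, of "ddir v f"]])
         (use csmooth_ddir[OF f, of v] csmooth_differentiable[OF f] in
           \<open>auto simp: csmooth_def ddir_chain(1)[where f=f and h=exp, OF _ DERIV_exp]\<close>)
    then show ?case using csmooth_differentiable[OF f] unfolding hdo_Suc
      by (auto intro: ddir_chain(2)[where f=f and h=exp, OF _ DERIV_exp])
  qed
  then show ?thesis using o by (simp add: csmooth_def)
qed

lemma csmooth_inverse:
  fixes f :: "'a::real_normed_vector \<Rightarrow> real"
  assumes f: "csmooth S f" and nz: "\<And>x. x \<in> S \<Longrightarrow> f x \<noteq> 0"
  shows "csmooth S (\<lambda>x. inverse (f x))"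
proof -
  note o = csmooth_open[OF f]
  have d: "x \<in> S \<Longrightarrow> (inverse has_real_derivative - (inverse (f x) * inverse (f x))) (at (f x))" for x
    using DERIV_inverse[OF nz] by (auto simp: power2_eq_square)
  have "higher_differentiable_on n S (\<lambda>x. inverse (f x))" for n
  proof (induction n)
    case 0 then show ?case using csmooth_continuous[OF f] nz by (auto intro: continuous_intros)
  next
    case (Suc n)
    have "higher_differentiable_on n S (ddir v (\<lambda>x. inverse (f x)))" for v
      by (rule hdo_cong[OF o _ hdo_mult[OF o hdo_mult[OF o Suc.IH Suc.IH], of "\<lambda>x. - ddir v f x"]])
         (use csmooth_minus[OF csmooth_ddir[OF f, of v]] csmooth_differentiable[OF f] in
           \<open>auto simp: csmooth_def ddir_chain(1)[where f=f and h=inverse, OF _ d]\<close>)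
    then show ?case using csmooth_differentiable[OF f] unfolding hdo_Suc
      by (auto intro: ddir_chain(2)[where f=f and h=inverse, OF _ d])
  qed
  then show ?thesis using o by (simp add: csmooth_def)
qed

lemma csmooth_divide:
  fixes f :: "'a::real_normed_vector \<Rightarrow> real"
  shows "csmooth S f \<Longrightarrow> csmooth S g \<Longrightarrow> (\<And>x. x \<in> S \<Longrightarrow> g x \<noteq> 0) \<Longrightarrow> csmooth S (\<lambda>x. f x / g x)"
  unfolding divide_inverse by (intro csmooth_mult csmooth_inverse)

text \<open>Already the first derivative is a quotient of smooth functions, so a case split on the
  order replaces the induction.\<close>

lemma csmooth_ln:
  fixes f :: "'a::real_normed_vector \<Rightarrow> real"
  assumes f: "csmooth S f" and pos: "\<And>x. x \<in> S \<Longrightarrow> f x > 0"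
  shows "csmooth S (\<lambda>x. ln (f x))"
proof -
  note o = csmooth_open[OF f]
  have nz: "x \<in> S \<Longrightarrow> f x \<noteq> 0" for x using pos[of x] by simp
  have d: "x \<in> S \<Longrightarrow> (ln has_real_derivative (inverse (f x))) (at (f x))" for x
    using DERIV_ln[OF pos] by (auto simp: divide_inverse)
  have "higher_differentiable_on n S (\<lambda>x. ln (f x))" for n
  proof (cases n)
    case 0 then show ?thesis using csmooth_continuous[OF f] nz by (auto intro!: continuous_intros)
  next
    case (Suc n)
    have "higher_differentiable_on n S (ddir v (\<lambda>x. ln (f x)))" for v
      by (rule hdo_cong[OF o, of "\<lambda>x. inverse (f x) * ddir v f x"])
         (use csmooth_mult[OF csmooth_inverse[OF f nz] csmooth_ddir[OF f, of v]]
            csmooth_differentiable[OF f] in \<open>auto simp: csmooth_def ddir_chain(1)[where f=f and h=ln, OF _ d]\<close>)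
    then show ?thesis using csmooth_differentiable[OF f] unfolding hdo_Suc Suc
      by (auto intro: ddir_chain(2)[where f=f and h=ln, OF _ d])
  qed
  then show ?thesis using o by (simp add: csmooth_def)
qed

text \<open>The linear part is constant, so differentiation merely replaces the direction
  \<open>v\<close> by \<open>L v\<close> and reproduces the same form. Serves for restriction to a
  time slice and for pulling functions of the space variable back to space-time.\<close>

lemma csmooth_affine:
  assumes f: "csmooth S f" and L: "bounded_linear L" and T: "open T" "\<And>x. x \<in> T \<Longrightarrow> L x + c \<in> S"
  shows "csmooth T (\<lambda>x. f (L x + c))"
    and "x \<in> T \<Longrightarrow> ddir v (\<lambda>x. f (L x + c)) x = ddir (L v) f (L x + c)"
proof -
  have hd: "((\<lambda>x. f (L x + c)) has_derivative (\<lambda>v. ddir (L v) f (L x + c))) (at x)"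
    if "csmooth S f" "x \<in> T" for x f
  proof -
    have "((\<lambda>x. L x + c) has_derivative L) (at x)"
      using bounded_linear_imp_has_derivative[OF L] by (auto intro!: derivative_eq_intros)
    from has_derivative_compose[OF this csmooth_has_derivative[OF that(1) T(2)[OF that(2)]]]
    show ?thesis by simp
  qed
  show 2: "x \<in> T \<Longrightarrow> ddir v (\<lambda>x. f (L x + c)) x = ddir (L v) f (L x + c)"
    by (rule ddir_eq[OF hd[OF f]])
  have cont: "continuous_on T (\<lambda>x. L x + c)"
    by (intro continuous_intros bounded_linear.continuous_on[OF L])
  have "higher_differentiable_on n T (\<lambda>x. f (L x + c))" for n
    using f
  proof (induction n arbitrary: f)
    case 0 then show ?case
      using continuous_on_compose2[OF csmooth_continuous[OF 0] cont] T by auto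
  next
    case (Suc n)
    have "higher_differentiable_on n T (ddir v (\<lambda>x. f (L x + c)))" for v
      by (rule hdo_cong[OF T(1) _ Suc.IH[OF csmooth_ddir[OF Suc.prems]]])
         (use ddir_eq[OF hd[OF Suc.prems]] in simp)
    then show ?case unfolding hdo_Suc using hd[OF Suc.prems] differentiable_def by blast
  qed
  then show "csmooth T (\<lambda>x. f (L x + c))" using T by (simp add: csmooth_def)
qed

section \<open>Restriction to lines and symmetry of second derivatives\<close>

lemma ddir_line:
  fixes f :: "'a::real_normed_vector \<Rightarrow> real"
  assumes "f differentiable (at (x + s *\<^sub>R v))"
  shows "((\<lambda>s. f (x + s *\<^sub>R v)) has_real_derivative ddir v f (x + s *\<^sub>R v)) (at s)"
proof -
  let ?D = "\<lambda>v'. ddir v' f (x + s *\<^sub>R v)"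
  have "linear ?D"
    using has_derivative_linear[OF has_derivative_ddir[OF assms]] .
  then have D: "?D (h *\<^sub>R v) = ?D v * h" for h using linear_cmul[of ?D h v] by simp
  have "((\<lambda>s. x + s *\<^sub>R v) has_derivative (\<lambda>h. h *\<^sub>R v)) (at s)"
    by (auto intro!: derivative_eq_intros)
  from has_derivative_compose[OF this, where g=f, OF has_derivative_ddir[OF assms]]
  show ?thesis by (simp add: has_field_derivative_def D)
qed

text \<open>The second difference over a small parallelogram is h^2 times a mixed derivative at an
  intermediate point, in either order; continuity of both mixed derivatives moves the intermediate
  points to \<open>x\<close>.\<close>

lemma ddir_commute:
  fixes f :: "'a::real_normed_vector \<Rightarrow> real"
  assumes f: "csmooth S f" and x: "x \<in> S"
  shows "ddir u (ddir v f) x = ddir v (ddir u f) x"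
proof -
  have mv: "\<exists>s r. 0 < s \<and> s < h \<and> 0 < r \<and> r < h \<and>
      f (x + h *\<^sub>R u + h *\<^sub>R v) - f (x + h *\<^sub>R u) - f (x + h *\<^sub>R v) + f x
        = h * h * ddir v (ddir u f) (x + s *\<^sub>R u + r *\<^sub>R v)"
    if h: "h > 0" "\<And>s r. 0 \<le> s \<Longrightarrow> s \<le> h \<Longrightarrow> 0 \<le> r \<Longrightarrow> r \<le> h \<Longrightarrow> x + s *\<^sub>R u + r *\<^sub>R v \<in> S"
    for u v h
  proof -
    \<comment> \<open>\<open>k\<close> is the difference across the edge
      \<open>h *\<^sub>R v\<close>, so \<open>k h - k 0\<close> is the full second difference; the
      mean value theorem is applied to \<open>k\<close> and then once more in direction
      \<open>v\<close>.\<close>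
    define k where "k s = f (x + h *\<^sub>R v + s *\<^sub>R u) - f (x + s *\<^sub>R u)" for s
    have "(k has_real_derivative ddir u f (x + h *\<^sub>R v + s *\<^sub>R u) - ddir u f (x + s *\<^sub>R u)) (at s)"
      if "0 \<le> s" "s \<le> h" for s
      unfolding k_def
      by (intro DERIV_diff ddir_line csmooth_differentiable[OF f])
         (use h(2)[OF that, of h] h(2)[OF that, of 0] h(1) in \<open>auto simp: algebra_simps\<close>)
    from MVT2[OF h(1) this] obtain s where s: "0 < s" "s < h"
      "k h - k 0 = h * (ddir u f (x + h *\<^sub>R v + s *\<^sub>R u) - ddir u f (x + s *\<^sub>R u))" by auto
    have "((\<lambda>r. ddir u f (x + s *\<^sub>R u + r *\<^sub>R v)) has_real_derivative
        ddir v (ddir u f) (x + s *\<^sub>R u + r *\<^sub>R v)) (at r)" if "0 \<le> r" "r \<le> h" for r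
      by (intro ddir_line csmooth_differentiable[OF csmooth_ddir[OF f]] h(2)) (use s that in auto)
    from MVT2[OF h(1) this] obtain r where r: "0 < r" "r < h"
      "ddir u f (x + s *\<^sub>R u + h *\<^sub>R v) - ddir u f (x + s *\<^sub>R u)
        = h * ddir v (ddir u f) (x + s *\<^sub>R u + r *\<^sub>R v)" by auto
    show ?thesis using s r by (intro exI[of _ s] exI[of _ r]) (auto simp: k_def algebra_simps)
  qed
  have le: "\<bar>ddir v (ddir u f) x - ddir u (ddir v f) x\<bar> \<le> 2 * e" if e: "e > 0" for e
  proof -
    have c: "continuous (at x) (ddir u (ddir v f))" for u v
      using csmooth_continuous[OF csmooth_ddir[OF csmooth_ddir[OF f]]] x csmooth_open[OF f]
      by (metis continuous_on_eq_continuous_at)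
    obtain d1 where d1: "d1 > 0" "\<And>y. dist y x < d1 \<Longrightarrow> dist (ddir u (ddir v f) y) (ddir u (ddir v f) x) < e"
      using c e unfolding continuous_at_eps_delta by blast
    obtain d2 where d2: "d2 > 0" "\<And>y. dist y x < d2 \<Longrightarrow> dist (ddir v (ddir u f) y) (ddir v (ddir u f) x) < e"
      using c e unfolding continuous_at_eps_delta by blast
    obtain d3 where d3: "d3 > 0" "ball x d3 \<subseteq> S"
      using csmooth_open[OF f] x openE by blast
    define d where "d = min d1 (min d2 d3)"
    \<comment> \<open>Small enough to keep the whole parallelogram in the ball of radius
      \<open>d\<close> about \<open>x\<close>; the summand 1 covers the case of two zero
      vectors.\<close>
    define h where "h = d / (2 * (norm u + norm v + 1))"
    have dp: "d > 0" using d1 d2 d3 by (simp add: d_def)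
    have np: "norm u + norm v + 1 > 0" by (smt (verit) norm_ge_zero)
    have hp: "h > 0" using dp np by (simp add: h_def)
    have "h * (norm u + norm v + 1) = d / 2" using np unfolding h_def by (simp add: divide_simps)
    then have hn: "h * (norm u + norm v + 1) < d" using dp by simp
    have near: "dist (x + s *\<^sub>R u + r *\<^sub>R v) x < d" if "0 \<le> s" "s \<le> h" "0 \<le> r" "r \<le> h" for s r
    proof -
      have "dist (x + s *\<^sub>R u + r *\<^sub>R v) x = norm (s *\<^sub>R u + r *\<^sub>R v)"
        by (simp add: dist_norm add.assoc)
      also have "\<dots> \<le> norm (s *\<^sub>R u) + norm (r *\<^sub>R v)" by (rule norm_triangle_ineq)
      also have "\<dots> \<le> h * norm u + h * norm v" using that by (auto intro!: add_mono mult_right_mono)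
      also have "\<dots> < d" using hn hp by (simp add: algebra_simps)
      finally show ?thesis .
    qed
    have inS: "x + s *\<^sub>R u + r *\<^sub>R v \<in> S" if "0 \<le> s" "s \<le> h" "0 \<le> r" "r \<le> h" for s r
      using near[OF that] d3(2) by (auto simp: d_def dist_commute)
    obtain s r where A: "0 < s" "s < h" "0 < r" "r < h"
      "f (x + h *\<^sub>R u + h *\<^sub>R v) - f (x + h *\<^sub>R u) - f (x + h *\<^sub>R v) + f x
        = h * h * ddir v (ddir u f) (x + s *\<^sub>R u + r *\<^sub>R v)"
      using mv[OF hp inS] by blast
    have inS': "x + s *\<^sub>R v + r *\<^sub>R u \<in> S" if "0 \<le> s" "s \<le> h" "0 \<le> r" "r \<le> h" for s r
      using inS[OF that(3,4,1,2)] by (simp add: algebra_simps)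
    obtain s' r' where B: "0 < s'" "s' < h" "0 < r'" "r' < h"
      "f (x + h *\<^sub>R v + h *\<^sub>R u) - f (x + h *\<^sub>R v) - f (x + h *\<^sub>R u) + f x
        = h * h * ddir u (ddir v f) (x + s' *\<^sub>R v + r' *\<^sub>R u)"
      using mv[OF hp inS'] by blast
    have "h * h * ddir v (ddir u f) (x + s *\<^sub>R u + r *\<^sub>R v)
        = h * h * ddir u (ddir v f) (x + r' *\<^sub>R u + s' *\<^sub>R v)"
      using A(5) B(5) by (simp add: algebra_simps)
    then have "ddir v (ddir u f) (x + s *\<^sub>R u + r *\<^sub>R v) = ddir u (ddir v f) (x + r' *\<^sub>R u + s' *\<^sub>R v)"
      using hp by simp
    moreover have "\<bar>ddir v (ddir u f) (x + s *\<^sub>R u + r *\<^sub>R v) - ddir v (ddir u f) x\<bar> < e"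
      using d2(2)[of "x + s *\<^sub>R u + r *\<^sub>R v"] near[of s r] A by (simp add: d_def dist_real_def)
    moreover have "\<bar>ddir u (ddir v f) (x + r' *\<^sub>R u + s' *\<^sub>R v) - ddir u (ddir v f) x\<bar> < e"
      using d1(2)[of "x + r' *\<^sub>R u + s' *\<^sub>R v"] near[of r' s'] B by (simp add: d_def dist_real_def)
    ultimately show ?thesis by linarith
  qed
  show ?thesis
  proof (rule ccontr)
    assume "\<not> ?thesis"
    then show False using le[of "\<bar>ddir v (ddir u f) x - ddir u (ddir v f) x\<bar> / 4"] by auto
  qed
qed

subsection \<open>Positive semidefinite matrices\<close>

lemma matrix_inv_right: "invertible A \<Longrightarrow> A ** matrix_inv A = mat 1"
  unfolding invertible_def matrix_inv_def by (rule someI_ex[THEN conjunct1])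

lemma matrix_inv_left: "invertible A \<Longrightarrow> matrix_inv A ** A = mat 1"
  unfolding invertible_def matrix_inv_def by (rule someI_ex[THEN conjunct2])

lemma matrix_diff_ldistrib: "(A::real^'n^'m) ** (B - C) = A ** B - A ** C"
  by (vector matrix_matrix_mult_def sum_subtractf right_diff_distrib)

lemma matrix_diff_rdistrib: "((A::real^'n^'m) - B) ** C = A ** C - B ** C"
  by (vector matrix_matrix_mult_def sum_subtractf left_diff_distrib)

lemma matrix_vector_axis: "((A::real^'n^'n) *v axis j s) $ i = A $ i $ j * s"
  by (simp add: matrix_vector_mult_def axis_def if_distrib cong: if_cong)

lemma symmetric_nth:
  assumes "transpose A = A"
  shows "A $ i $ j = A $ j $ i"
proof -
  have "transpose A $ i $ j = A $ j $ i" by (simp add: transpose_def)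
  then show ?thesis using assms by simp
qed

lemma quad_form_axis_pair:
  fixes A :: "real^'n^'n"
  assumes "transpose A = A"
  shows "(axis i s + axis j r) \<bullet> (A *v (axis i s + axis j r))
     = s * s * A $ i $ i + 2 * s * r * A $ i $ j + r * r * A $ j $ j"
proof -
  have "A $ j $ i = A $ i $ j" using assms by (rule symmetric_nth)
  then show ?thesis
    by (simp add: matrix_vector_right_distrib inner_add_left inner_add_right inner_axis'
        matrix_vector_axis algebra_simps)
qed

text \<open>When the diagonal entry at \<open>i\<close> vanishes, the form on
  \<open>axis i s + axis j 1\<close> is affine in \<open>s\<close>, and an affine function bounded
  below has slope 0.\<close>

lemma psd_diag_zero_imp_row_zero:
  fixes A :: "real^'n^'n"
  assumes sym: "transpose A = A" and psd: "\<And>v. v \<bullet> (A *v v) \<ge> 0" and z: "A $ i $ i = 0"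
  shows "A $ i $ j = 0"
proof (rule ccontr)
  assume nz: "A $ i $ j \<noteq> 0"
  \<comment> \<open>This value makes the form equal to -1.\<close>
  define s where "s = - (A $ j $ j + 1) / (2 * A $ i $ j)"
  have "s * s * A $ i $ i + 2 * s * 1 * A $ i $ j + 1 * 1 * A $ j $ j \<ge> 0"
    using psd[of "axis i s + axis j 1"] unfolding quad_form_axis_pair[OF sym] .
  moreover have "2 * s * A $ i $ j = - (A $ j $ j + 1)" using nz by (simp add: s_def field_simps)
  ultimately show False using z by simp
qed

text \<open>One step of symmetric Gaussian elimination splits off a rank-one positive part of \<open>A\<close>.\<close>

lemma psd_pairing_nonneg:
  fixes A B :: "real^'n^'n"
  assumes "transpose A = A" and "\<And>v. v \<bullet> (A *v v) \<ge> 0" and B: "\<And>v. v \<bullet> (B *v v) \<ge> 0"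
  shows "(\<Sum>i\<in>UNIV. \<Sum>j\<in>UNIV. A $ i $ j * B $ i $ j) \<ge> 0"
  using assms(1,2)
\<comment> \<open>Each elimination step clears the pivot on the diagonal; once the diagonal is zero,
  so is the whole matrix.\<close>
proof (induction "card {i. A $ i $ i \<noteq> 0}" arbitrary: A rule: less_induct)
  case less
  note sym = less.prems(1) and psd = less.prems(2)
  have symA: "A $ i $ j = A $ j $ i" for i j using sym by (rule symmetric_nth)
  show ?case
  proof (cases "\<exists>k. A $ k $ k \<noteq> 0")
    case False
    then show ?thesis using psd_diag_zero_imp_row_zero[OF sym psd] by simp
  next
    case True
    then obtain k where k: "A $ k $ k \<noteq> 0" by blast
    have "(axis k 1 + axis k 0) \<bullet> (A *v (axis k 1 + axis k 0)) \<ge> 0" by (rule psd)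
    then have kp: "A $ k $ k > 0" using k unfolding quad_form_axis_pair[OF sym] by simp
    define b where "b = A $ k"
    define A' where "A' = (\<chi> i j. A $ i $ j - b $ i * b $ j / A $ k $ k)"
    have sym': "transpose A' = A'"
      by (simp add: A'_def transpose_def vec_eq_iff symA mult.commute)
    have quad: "v \<bullet> (A' *v v) = v \<bullet> (A *v v) - (b \<bullet> v)\<^sup>2 / A $ k $ k" for v
    proof -
      have "v \<bullet> (A' *v v) = v \<bullet> (A *v v) - (\<Sum>i\<in>UNIV. \<Sum>j\<in>UNIV. v $ i * (b $ i * b $ j / A $ k $ k * v $ j))"
        by (simp add: A'_def inner_vec_def matrix_vector_mult_def sum_distrib_left left_diff_distrib right_diff_distrib sum_subtractf)
      also have "(\<Sum>i\<in>UNIV. \<Sum>j\<in>UNIV. v $ i * (b $ i * b $ j / A $ k $ k * v $ j)) = (b \<bullet> v)\<^sup>2 / A $ k $ k"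
        by (simp add: inner_vec_def power2_eq_square sum_product sum_divide_distrib mult_ac)
      finally show ?thesis .
    qed
    have psd': "v \<bullet> (A' *v v) \<ge> 0" for v
    proof -
      \<comment> \<open>Minimises the form along the \<open>k\<close>-th axis; the minimum is the
        quadratic form of the Schur complement \<open>A'\<close>.\<close>
      define s where "s = - (b \<bullet> v) / A $ k $ k"
      have bv: "(A *v v) $ k = b \<bullet> v" by (simp add: b_def matrix_vector_mult_def inner_vec_def)
      have Aax: "v \<bullet> (A *v axis k s) = s * (b \<bullet> v)"
        by (simp add: matrix_vector_mult_def inner_vec_def axis_def if_distrib sum_distrib_left symA[of _ k] b_def mult_ac cong: if_cong)
      have "0 \<le> (v + axis k s) \<bullet> (A *v (v + axis k s))" by (rule psd)
      also have "\<dots> = v \<bullet> (A *v v) + 2 * s * (b \<bullet> v) + s * s * A $ k $ k"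
        by (simp add: matrix_vector_right_distrib inner_add_left inner_add_right Aax inner_axis' bv
            matrix_vector_axis)
      also have "\<dots> = v \<bullet> (A' *v v)" unfolding quad s_def using kp by (simp add: field_simps power2_eq_square)
      finally show ?thesis .
    qed
    \<comment> \<open>Zero diagonal entries stay zero because their whole row vanishes; together
      with the cleared pivot this gives the strict decrease.\<close>
    have dz: "A' $ i $ i = 0" if "A $ i $ i = 0" for i
      using psd_diag_zero_imp_row_zero[OF sym psd that, of k] that symA[of k i] by (simp add: A'_def b_def)
    have "A' $ k $ k = 0" using k by (simp add: A'_def b_def)
    then have "{i. A' $ i $ i \<noteq> 0} \<subset> {i. A $ i $ i \<noteq> 0}" using dz k by auto
    then have "card {i. A' $ i $ i \<noteq> 0} < card {i. A $ i $ i \<noteq> 0}" by (intro psubset_card_mono) auto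
    from less.hyps[OF this sym' psd'] have IH: "0 \<le> (\<Sum>i\<in>UNIV. \<Sum>j\<in>UNIV. A' $ i $ j * B $ i $ j)" .
    have "(\<Sum>i\<in>UNIV. \<Sum>j\<in>UNIV. A $ i $ j * B $ i $ j)
        = (\<Sum>i\<in>UNIV. \<Sum>j\<in>UNIV. A' $ i $ j * B $ i $ j + b $ i * (B $ i $ j * b $ j) / A $ k $ k)"
      by (intro sum.cong refl) (simp add: A'_def algebra_simps)
    also have "\<dots> = (\<Sum>i\<in>UNIV. \<Sum>j\<in>UNIV. A' $ i $ j * B $ i $ j) + (b \<bullet> (B *v b)) / A $ k $ k"
      unfolding sum.distrib by (simp add: inner_vec_def matrix_vector_mult_def sum_distrib_left sum_divide_distrib)
    finally have "(\<Sum>i\<in>UNIV. \<Sum>j\<in>UNIV. A $ i $ j * B $ i $ j)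
        = (\<Sum>i\<in>UNIV. \<Sum>j\<in>UNIV. A' $ i $ j * B $ i $ j) + (b \<bullet> (B *v b)) / A $ k $ k" .
    then show ?thesis using IH B[of b] kp by simp
  qed
qed

lemma pos_def_invertible:
  fixes G :: "real^'n^'n"
  assumes "\<And>v. v \<noteq> 0 \<Longrightarrow> v \<bullet> (G *v v) > 0"
  shows "invertible G"
proof -
  have "G *v v = 0 \<Longrightarrow> v = 0" for v using assms[of v] by force
  then show ?thesis using matrix_left_invertible_ker[of G] invertible_left_inverse by blast
qed

lemma matrix_inv_symmetric:
  fixes G :: "real^'n^'n"
  assumes "invertible G" "transpose G = G"
  shows "transpose (matrix_inv G) = matrix_inv G"
proof -
  have "transpose (matrix_inv G) ** G = mat 1"
    by (metis assms matrix_inv_right matrix_transpose_mul transpose_mat)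
  then show ?thesis
    by (metis assms(1) matrix_inv_right matrix_mul_assoc matrix_mul_lid matrix_mul_rid)
qed

lemma matrix_inv_psd:
  fixes G :: "real^'n^'n"
  assumes "\<And>v. v \<noteq> 0 \<Longrightarrow> v \<bullet> (G *v v) > 0" "transpose G = G"
  shows "v \<bullet> (matrix_inv G *v v) \<ge> 0"
proof -
  have i: "invertible G" by (rule pos_def_invertible[OF assms(1)])
  define x where "x = matrix_inv G *v v"
  have "G *v x = v" by (simp add: x_def matrix_vector_mul_assoc matrix_inv_right[OF i])
  then have "v \<bullet> (matrix_inv G *v v) = x \<bullet> (G *v x)" by (simp add: x_def inner_commute)
  then show ?thesis using assms(1)[of x] by (cases "x = 0") (auto simp: less_imp_le)
qed

text \<open>\<open>M\<close> is self-adjoint for the inner product \<open>G\<close>. With S = G M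
  and H the inverse of \<open>G\<close> one has M = H S, and the trace of M M is the entrywise
  pairing of the positive semidefinite matrices H and S H S. This takes the place of a
  diagonalisation.\<close>

lemma trace_square_nonneg:
  fixes G M :: "real^'n^'n"
  assumes pos: "\<And>v. v \<noteq> 0 \<Longrightarrow> v \<bullet> (G *v v) > 0" and sym: "transpose G = G"
    and sa: "transpose (G ** M) = G ** M"
  shows "trace (M ** M) \<ge> 0"
proof -
  have i: "invertible G" by (rule pos_def_invertible[OF pos])
  let ?H = "matrix_inv G"
  let ?S = "G ** M"
  let ?B = "?S ** (?H ** ?S)"
  have Hs: "transpose ?H = ?H" by (rule matrix_inv_symmetric[OF i sym])
  have M: "M = ?H ** ?S" by (simp add: matrix_mul_assoc matrix_inv_left[OF i])
  have quad: "v \<bullet> (?B *v v) = (?S *v v) \<bullet> (?H *v (?S *v v))" for v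
  proof -
    have "(S *v v) \<bullet> x = v \<bullet> (S *v x)" if "transpose S = S" for S :: "real^'n^'n" and x
      using dot_lmul_matrix[of v S x] transpose_matrix_vector[of S v] that by simp
    then show ?thesis using sa by (simp only: matrix_vector_mul_assoc)
  qed
  have "0 \<le> (\<Sum>i\<in>UNIV. \<Sum>j\<in>UNIV. ?H $ i $ j * ?B $ i $ j)"
    by (rule psd_pairing_nonneg[OF Hs matrix_inv_psd[OF pos sym]])
       (simp_all add: quad matrix_inv_psd[OF pos sym])
  also have "\<dots> = trace (?B ** ?H)"
  proof -
    have "?H $ i $ j = ?H $ j $ i" for i j using Hs by (rule symmetric_nth)
    then show ?thesis by (simp add: trace_def matrix_matrix_mult_def mult.commute)
  qed
  also have "\<dots> = trace (M ** M)"
    by (subst trace_mul_sym) (subst (3 4) M, simp add: matrix_mul_assoc)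
  finally show ?thesis .
qed

text \<open>The trace-free part of \<open>M\<close> is again self-adjoint, and the trace of its
  square is the difference of the two sides. This is the Cauchy-Schwarz bound that turns the squared
  Hessian into the squared Laplacian.\<close>

lemma trace_square_ge:
  fixes G M :: "real^'n^'n"
  assumes pos: "\<And>v. v \<noteq> 0 \<Longrightarrow> v \<bullet> (G *v v) > 0" and sym: "transpose G = G"
    and sa: "transpose (G ** M) = G ** M"
  shows "trace (M ** M) \<ge> (trace M)\<^sup>2 / real CARD('n)"
proof -
  let ?n = "real CARD('n)"
  have n: "?n > 0" by simp
  define c where "c = trace M / ?n"
  define P where "P = M - c *\<^sub>R mat 1"
  have GP: "G ** P = G ** M - c *\<^sub>R G"
    by (simp add: P_def matrix_diff_ldistrib matrix_scalar_ac scalar_matrix_assoc[symmetric])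
  have "transpose (G ** P) = G ** P"
    unfolding GP using sa sym by (simp add: vec_eq_iff transpose_def)
  from trace_square_nonneg[OF pos sym this] have "0 \<le> trace (P ** P)" .
  also have "P ** P = M ** M - (2 * c) *\<^sub>R M + (c * c) *\<^sub>R mat 1"
    by (simp add: P_def matrix_diff_ldistrib matrix_diff_rdistrib matrix_scalar_ac scalar_matrix_assoc[symmetric] vec_eq_iff right_diff_distrib mult.assoc)
  also have "trace \<dots> = trace (M ** M) - 2 * c * trace M + c * c * ?n"
    by (simp add: trace_def sum_subtractf sum.distrib sum_distrib_left[symmetric] mat_def)
  also have "\<dots> = trace (M ** M) - (trace M)\<^sup>2 / ?n"
    using n by (simp add: c_def field_simps power2_eq_square)
  finally show ?thesis by simp
qed

subsection \<open>The Bochner formula in a chart\<close>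

lemma pderiv_at_eq: "pderiv_at i f = ddir (axis i 1) f"
  by (auto simp: pderiv_at_def ddir_def)

lemma csmooth_pderiv: "csmooth V f \<Longrightarrow> csmooth V (pderiv_at i f)"
  unfolding pderiv_at_eq by (rule csmooth_ddir)

lemma pderiv_const [simp]: "pderiv_at i (\<lambda>_. c) y = 0"
  by (simp add: pderiv_at_eq)

lemma pderiv_cong:
  "open V \<Longrightarrow> y \<in> V \<Longrightarrow> (\<And>z. z \<in> V \<Longrightarrow> f z = h z) \<Longrightarrow> pderiv_at i f y = pderiv_at i h y"
  unfolding pderiv_at_eq by (rule ddir_cong_open)

lemma pderiv_add:
  "csmooth V f \<Longrightarrow> csmooth V h \<Longrightarrow> y \<in> V \<Longrightarrow>
    pderiv_at i (\<lambda>z. f z + h z) y = pderiv_at i f y + pderiv_at i h y"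
  unfolding pderiv_at_eq by (intro ddir_add csmooth_differentiable)

lemma pderiv_mult:
  "csmooth V f \<Longrightarrow> csmooth V h \<Longrightarrow> y \<in> V \<Longrightarrow>
    pderiv_at i (\<lambda>z. f z * h z) y = pderiv_at i f y * h y + f y * pderiv_at i h y"
  unfolding pderiv_at_eq by (intro ddir_mult csmooth_differentiable)

lemma pderiv_cmult:
  "csmooth V f \<Longrightarrow> y \<in> V \<Longrightarrow> pderiv_at i (\<lambda>z. c * f z) y = c * pderiv_at i f y"
  by (subst pderiv_mult[OF csmooth_const[OF csmooth_open]]) auto

lemma pderiv_sum:
  assumes "open V" "y \<in> V" "\<And>j. j \<in> I \<Longrightarrow> csmooth V (f j)"
  shows "pderiv_at i (\<lambda>z. \<Sum>j\<in>I. f j z) y = (\<Sum>j\<in>I. pderiv_at i (f j) y)"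
  unfolding pderiv_at_eq by (rule ddir_sum[OF assms])

lemma pderiv_commute:
  "csmooth V f \<Longrightarrow> y \<in> V \<Longrightarrow> pderiv_at i (pderiv_at j f) y = pderiv_at j (pderiv_at i f) y"
  unfolding pderiv_at_eq by (rule ddir_commute)

lemma ddir_expand:
  fixes f :: "real^'n \<Rightarrow> real"
  assumes "f differentiable (at x)"
  shows "ddir v f x = (\<Sum>i\<in>UNIV. v $ i * pderiv_at i f x)"
proof -
  have lin: "linear (\<lambda>v. ddir v f x)"
    using has_derivative_linear[OF has_derivative_ddir[OF assms]] .
  have "ddir v f x = ddir (\<Sum>i\<in>UNIV. v $ i *\<^sub>R axis i 1) f x"
    using basis_expansion[of v] by (simp add: scalar_mult_eq_scaleR)
  also have "\<dots> = (\<Sum>i\<in>UNIV. v $ i * pderiv_at i f x)"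
    by (simp add: linear_sum[OF lin] linear_cmul[OF lin] pderiv_at_eq)
  finally show ?thesis .
qed

text \<open>If the second derivative along the line were positive, the first derivative, which
  vanishes at \<open>y\<close>, would be positive just after it, and the mean value theorem would
  yield a larger value.\<close>

lemma local_max_directional:
  fixes f :: "'a::real_normed_vector \<Rightarrow> real"
  assumes f: "csmooth V f" and y: "y \<in> V" and max: "\<And>z. z \<in> V \<Longrightarrow> f z \<le> f y"
  shows "ddir v f y = 0" and "ddir v (ddir v f) y \<le> 0"
proof -
  have "open ((\<lambda>s::real. y + s *\<^sub>R v) -` V)"
    by (intro open_vimage csmooth_open[OF f] continuous_intros)
  moreover have "0 \<in> (\<lambda>s::real. y + s *\<^sub>R v) -` V" using y by simp
  ultimately obtain e where e: "e > 0" "ball 0 e \<subseteq> (\<lambda>s::real. y + s *\<^sub>R v) -` V"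
    using openE by metis
  then have inV: "y + s *\<^sub>R v \<in> V" if "\<bar>s\<bar> < e" for s using that by (auto simp: subset_iff)
  have d: "((\<lambda>s. h (y + s *\<^sub>R v)) has_real_derivative ddir v h (y + s *\<^sub>R v)) (at s)"
    if "\<bar>s\<bar> < e" "csmooth V h" for s h
    by (intro ddir_line csmooth_differentiable[OF that(2)] inV that)
  show z: "ddir v f y = 0"
    using DERIV_local_max[OF d[OF _ f, of 0] e(1)] max inV e(1) by auto
  show "ddir v (ddir v f) y \<le> 0"
  proof (rule ccontr)
    assume "\<not> ?thesis"
    then obtain r where r: "r > 0" "\<And>h. 0 < h \<Longrightarrow> h < r \<Longrightarrow> ddir v f y < ddir v f (y + h *\<^sub>R v)"
      using DERIV_pos_inc_right[OF d[OF _ csmooth_ddir[OF f], of 0 v]] e(1) by auto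
    define h where "h = min (r / 2) (e / 2)"
    have h: "0 < h" "h < r" "h < e" using r(1) e(1) by (auto simp: h_def)
    obtain s where s: "0 < s" "s < h" "f (y + h *\<^sub>R v) - f (y + 0 *\<^sub>R v) = (h - 0) * ddir v f (y + s *\<^sub>R v)"
      using MVT2[OF h(1), of "\<lambda>s. f (y + s *\<^sub>R v)" "\<lambda>s. ddir v f (y + s *\<^sub>R v)"] d[OF _ f] h by auto
    have "ddir v f (y + s *\<^sub>R v) > 0" using r(2)[of s] s h z by simp
    then have "f (y + h *\<^sub>R v) > f y" using s(3) h by (simp add: zero_less_mult_iff algebra_simps)
    then show False using max[OF inV[of h]] h by auto
  qed
qed

text \<open>The endomorphism that sends a vector to the covariant derivative of \<open>X\<close> in
  its direction: rows carry the component, columns the direction. For a gradient field it is the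
  Hessian with one index raised.\<close>

definition covd :: "(real^'n \<Rightarrow> real^'n^'n) \<Rightarrow> (real^'n \<Rightarrow> real^'n) \<Rightarrow> real^'n::finite \<Rightarrow> real^'n^'n" where
  "covd G X y = (\<chi> i j. pderiv_at j (\<lambda>z. X z $ i) y + (\<Sum>m\<in>UNIV. christoffel G i j m y * X y $ m))"

lemma covd_nth: "covd G X y $ i $ j =
    pderiv_at j (\<lambda>z. X z $ i) y + (\<Sum>m\<in>UNIV. christoffel G i j m y * X y $ m)"
  by (simp add: covd_def)

lemma divergence_eq_trace: "divergence G X y = trace (covd G X y)"
  by (simp add: divergence_def trace_def covd_nth)

section \<open>Smoothness of determinants and inverse matrices\<close>

lemma csmooth_det:
  assumes "open S" "\<And>i j. csmooth S (\<lambda>y. M y $ i $ j)"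
  shows "csmooth S (\<lambda>y. det (M y :: real^'n^'n))"
  unfolding det_def by (intro csmooth_sum csmooth_mult csmooth_const csmooth_prod assms)

text \<open>\<open>matrix_inv\<close> is defined by choice; Cramer's rule writes its entries as
  quotients of determinants, whose smoothness is visible.\<close>

lemma csmooth_matrix_inv:
  fixes M :: "'a::real_normed_vector \<Rightarrow> real^'n^'n"
  assumes o: "open S" and M: "\<And>i j. csmooth S (\<lambda>y. M y $ i $ j)"
    and inv: "\<And>y. y \<in> S \<Longrightarrow> invertible (M y)"
  shows "csmooth S (\<lambda>y. matrix_inv (M y) $ k $ l)"
proof -
  let ?D = "\<lambda>y. det (\<chi> i j. if j = k then (axis l 1 :: real^'n) $ i else M y $ i $ j)"
  have nz: "y \<in> S \<Longrightarrow> det (M y) \<noteq> 0" for y using inv invertible_det_nz by blast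
  have "matrix_inv (M y) $ k $ l = ?D y / det (M y)" if "y \<in> S" for y
  proof -
    have "M y *v (matrix_inv (M y) *v axis l 1) = axis l 1"
      by (simp add: matrix_vector_mul_assoc matrix_inv_right[OF inv[OF that]])
    then have "matrix_inv (M y) *v axis l 1 =
        (\<chi> k. det (\<chi> i j. if j = k then (axis l 1 :: real^'n) $ i else M y $ i $ j) / det (M y))"
      using cramer[OF nz[OF that]] by blast
    then show ?thesis using matrix_vector_axis[of "matrix_inv (M y)" l 1 k] by simp
  qed
  moreover have "csmooth S (\<lambda>y. ?D y / det (M y))"
  proof (intro csmooth_divide csmooth_det o M nz)
    fix i j show "csmooth S (\<lambda>y. (\<chi> i j. if j = k then (axis l 1 :: real^'n) $ i else M y $ i $ j) $ i $ j)"
      using M[of i j] csmooth_const[OF o] by (cases "j = k") auto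
  qed auto
  ultimately show ?thesis by (metis (no_types, lifting) csmooth_cong)
qed

text \<open>The geometry of a single chart, detached from the manifold: the Bochner formula and the
  second order condition at a maximum are statements about a metric on an open subset of
  R^n.\<close>

locale local_metric =
  fixes V :: "(real^'n::finite) set" and G :: "real^'n \<Rightarrow> real^'n^'n"
  assumes open_V: "open V"
    and G_smooth: "csmooth V G"
    and G_sym: "y \<in> V \<Longrightarrow> transpose (G y) = G y"
    and G_pos: "y \<in> V \<Longrightarrow> v \<noteq> 0 \<Longrightarrow> metric_inner G y v v > 0"
begin

lemma G_pos': "y \<in> V \<Longrightarrow> v \<noteq> 0 \<Longrightarrow> v \<bullet> (G y *v v) > 0"
  using G_pos by (simp add: metric_inner_def)

lemma G_inv: "y \<in> V \<Longrightarrow> invertible (G y)"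
  by (rule pos_def_invertible[OF G_pos'])

lemma G_nth_sym: "y \<in> V \<Longrightarrow> G y $ i $ j = G y $ j $ i"
  by (rule symmetric_nth[OF G_sym])

lemma csmooth_G: "csmooth V (\<lambda>y. G y $ i $ j)"
  by (intro csmooth_bounded_linear[of "\<lambda>x. x $ j"] csmooth_bounded_linear[of "\<lambda>x. x $ i"]
      bounded_linear_vec_nth G_smooth)

lemma csmooth_H: "csmooth V (\<lambda>y. matrix_inv (G y) $ i $ j)"
  by (rule csmooth_matrix_inv[OF open_V csmooth_G G_inv])

lemma H_sym: "y \<in> V \<Longrightarrow> transpose (matrix_inv (G y)) = matrix_inv (G y)"
  by (rule matrix_inv_symmetric[OF G_inv G_sym])

lemma csmooth_christoffel: "csmooth V (christoffel G k i j)"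
  unfolding christoffel_def[abs_def]
  by (intro csmooth_divide csmooth_sum csmooth_mult csmooth_diff csmooth_add csmooth_pderiv
      csmooth_G csmooth_H csmooth_const open_V) auto

lemma pderiv_G_sym: "y \<in> V \<Longrightarrow> pderiv_at l (\<lambda>z. G z $ i $ j) y = pderiv_at l (\<lambda>z. G z $ j $ i) y"
  by (rule pderiv_cong[OF open_V]) (auto simp: G_nth_sym)

lemma christoffel_sym:
  assumes "y \<in> V"
  shows "christoffel G k i j y = christoffel G k j i y"
  unfolding christoffel_def pderiv_G_sym[OF assms, of _ i j]
  by (simp only: add.commute)

text \<open>Lowering the index cancels the inverse matrix in \<open>christoffel\<close>, so the
  Hessian computations involve derivatives of the entries of \<open>G\<close> only.\<close>

lemma christoffel_lowered:
  assumes "y \<in> V"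
  shows "(\<Sum>k\<in>UNIV. G y $ m $ k * christoffel G k i j y) =
    (pderiv_at i (\<lambda>z. G z $ j $ m) y + pderiv_at j (\<lambda>z. G z $ i $ m) y
           - pderiv_at m (\<lambda>z. G z $ i $ j) y) / 2"
proof -
  define b where "b = (\<chi> l. (pderiv_at i (\<lambda>z. G z $ j $ l) y + pderiv_at j (\<lambda>z. G z $ i $ l) y
           - pderiv_at l (\<lambda>z. G z $ i $ j) y) / 2)"
  have "christoffel G k i j y = (matrix_inv (G y) *v b) $ k" for k
    by (simp add: christoffel_def b_def matrix_vector_mult_def sum_divide_distrib)
  then have "(\<Sum>k\<in>UNIV. G y $ m $ k * christoffel G k i j y) = (G y *v (matrix_inv (G y) *v b)) $ m"
    by (simp add: matrix_vector_mult_def)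
  then show ?thesis
    by (simp add: matrix_vector_mul_assoc matrix_inv_right[OF G_inv[OF assms]] b_def)
qed

lemma csmooth_covd:
  "(\<And>i. csmooth V (\<lambda>y. X y $ i)) \<Longrightarrow> csmooth V (\<lambda>y. covd G X y $ i $ j)"
  unfolding covd_nth
  by (intro csmooth_add csmooth_pderiv csmooth_sum csmooth_mult csmooth_christoffel open_V)

text \<open>The second derivatives of \<open>X\<close> cancel, the derivatives and products of
  Christoffel symbols form \<open>riemann\<close>, and the terms with first derivatives of
  \<open>X\<close> are completed to entries of \<open>covd\<close>. The index \<open>i\<close> is
  fixed here; the contraction follows in \<open>divergence_covd_self\<close>.\<close>

lemma ricci_identity:
  assumes X: "\<And>i. csmooth V (\<lambda>y. X y $ i)" and y: "y \<in> V"
  shows "pderiv_at i (\<lambda>z. covd G X z $ i $ m) y - pderiv_at m (\<lambda>z. covd G X z $ i $ i) y =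
    (\<Sum>k\<in>UNIV. riemann G i k i m y * X y $ k)
    + (\<Sum>j\<in>UNIV. christoffel G i m j y * covd G X y $ j $ i)
    - (\<Sum>j\<in>UNIV. christoffel G i i j y * covd G X y $ j $ m)"
proof -
  let ?C = "christoffel G"
  have D: "pderiv_at r (\<lambda>z. covd G X z $ i $ s) y = pderiv_at r (pderiv_at s (\<lambda>z. X z $ i)) y
      + (\<Sum>k\<in>UNIV. pderiv_at r (?C i s k) y * X y $ k + ?C i s k y * pderiv_at r (\<lambda>z. X z $ k) y)" for r s
    unfolding covd_nth
    by (subst pderiv_add[OF csmooth_pderiv[OF X] csmooth_sum[OF open_V csmooth_mult[OF csmooth_christoffel X]] y])
       (simp add: pderiv_sum[OF open_V y csmooth_mult[OF csmooth_christoffel X]]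
         pderiv_mult[OF csmooth_christoffel X y])
  have R: "(\<Sum>k\<in>UNIV. riemann G i k i m y * X y $ k) =
     (\<Sum>k\<in>UNIV. pderiv_at i (?C i m k) y * X y $ k) - (\<Sum>k\<in>UNIV. pderiv_at m (?C i i k) y * X y $ k)
     + (\<Sum>k\<in>UNIV. \<Sum>j\<in>UNIV. ?C i i j y * ?C j m k y * X y $ k)
     - (\<Sum>k\<in>UNIV. \<Sum>j\<in>UNIV. ?C i m j y * ?C j i k y * X y $ k)"
    unfolding riemann_def
    by (simp add: distrib_right left_diff_distrib sum.distrib sum_subtractf sum_distrib_right)
  have N: "(\<Sum>j\<in>UNIV. ?C i r j y * covd G X y $ j $ s) =
     (\<Sum>j\<in>UNIV. ?C i r j y * pderiv_at s (\<lambda>z. X z $ j) y)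
     + (\<Sum>k\<in>UNIV. \<Sum>j\<in>UNIV. ?C i r j y * ?C j s k y * X y $ k)" for r s
    unfolding covd_nth
    by (subst sum.swap) (simp add: distrib_left sum.distrib sum_distrib_left mult.assoc)
  show ?thesis
    unfolding D R N using pderiv_commute[OF X y, of i m i] by (simp add: sum.distrib)
qed

text \<open>With N = \<open>covd G X\<close>, the product rule splits the left-hand side into the
  covariant divergence of N, applied to X, and the trace of N N. Commuting derivatives in the former
  produces the Ricci term.\<close>

lemma divergence_covd_self:
  assumes X: "\<And>i. csmooth V (\<lambda>y. X y $ i)" and y: "y \<in> V"
  shows "divergence G (\<lambda>z. covd G X z *v X z) y =
    (\<Sum>m\<in>UNIV. X y $ m * pderiv_at m (divergence G X) y) + ricci G y (X y) (X y)
    + trace (covd G X y ** covd G X y)"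
proof -
  let ?C = "christoffel G" and ?N = "\<lambda>i j. covd G X y $ i $ j" and ?x = "\<lambda>i. X y $ i"
  have P: "pderiv_at i (\<lambda>z. (covd G X z *v X z) $ i) y =
      (\<Sum>m\<in>UNIV. pderiv_at i (\<lambda>z. covd G X z $ i $ m) y * ?x m + ?N i m * pderiv_at i (\<lambda>z. X z $ m) y)" for i
    by (simp add: matrix_vector_mult_def pderiv_sum[OF open_V y csmooth_mult[OF csmooth_covd[OF X] X]]
        pderiv_mult[OF csmooth_covd[OF X] X y])
  have L: "divergence G (\<lambda>z. covd G X z *v X z) y =
      (\<Sum>i\<in>UNIV. \<Sum>m\<in>UNIV. pderiv_at i (\<lambda>z. covd G X z $ i $ m) y * ?x m)
      + (\<Sum>i\<in>UNIV. \<Sum>m\<in>UNIV. ?N i m * pderiv_at i (\<lambda>z. X z $ m) y)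
      + (\<Sum>i\<in>UNIV. \<Sum>j\<in>UNIV. \<Sum>m\<in>UNIV. ?C i i j y * ?N j m * ?x m)"
    unfolding divergence_def P
    by (simp add: sum.distrib matrix_vector_mult_def sum_distrib_left mult.assoc)
  have T: "trace (covd G X y ** covd G X y) =
      (\<Sum>i\<in>UNIV. \<Sum>m\<in>UNIV. ?N i m * pderiv_at i (\<lambda>z. X z $ m) y)
      + (\<Sum>i\<in>UNIV. \<Sum>m\<in>UNIV. \<Sum>k\<in>UNIV. ?N i m * ?C m i k y * ?x k)"
  proof -
    \<comment> \<open>Only the second factor is expanded, so that the terms with derivatives of
      \<open>X\<close> agree with those in \<open>L\<close>.\<close>
    have "?N i m * ?N m i = ?N i m * pderiv_at i (\<lambda>z. X z $ m) y + (\<Sum>k\<in>UNIV. ?N i m * ?C m i k y * ?x k)" for i m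
      by (subst (2) covd_nth) (simp add: distrib_left sum_distrib_left mult.assoc)
    then show ?thesis by (simp add: trace_def matrix_matrix_mult_def sum.distrib)
  qed
  have R: "ricci G y (X y) (X y) = (\<Sum>m\<in>UNIV. \<Sum>i\<in>UNIV. (\<Sum>k\<in>UNIV. riemann G i k i m y * ?x k) * ?x m)"
    unfolding ricci_def sum_distrib_right
    by (rule sum.cong[OF refl], subst sum.swap) (simp add: mult_ac)
  \<comment> \<open>The left-hand side is the covariant divergence of N, a tensor with one upper and
    one lower index. It is \<open>ricci_identity\<close> summed over \<open>i\<close>; the last sum
    is matched by the symmetry of the Christoffel symbols in their lower indices.\<close>
  have key: "(\<Sum>i\<in>UNIV. pderiv_at i (\<lambda>z. covd G X z $ i $ m) y)
      + (\<Sum>i\<in>UNIV. \<Sum>j\<in>UNIV. ?C i i j y * ?N j m) - (\<Sum>i\<in>UNIV. \<Sum>j\<in>UNIV. ?N i j * ?C j i m y)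
      = pderiv_at m (divergence G X) y + (\<Sum>i\<in>UNIV. \<Sum>k\<in>UNIV. riemann G i k i m y * ?x k)" for m
  proof -
    have "pderiv_at m (divergence G X) y = (\<Sum>i\<in>UNIV. pderiv_at m (\<lambda>z. covd G X z $ i $ i) y)"
      unfolding divergence_eq_trace[abs_def] trace_def
      by (rule pderiv_sum[OF open_V y csmooth_covd[OF X]])
    moreover have "(\<Sum>i\<in>UNIV. \<Sum>j\<in>UNIV. ?C i m j y * ?N j i) = (\<Sum>i\<in>UNIV. \<Sum>j\<in>UNIV. ?N i j * ?C j i m y)"
      by (subst sum.swap) (simp add: christoffel_sym[OF y, of _ m] mult.commute)
    moreover have "(\<Sum>i\<in>UNIV. pderiv_at i (\<lambda>z. covd G X z $ i $ m) y - pderiv_at m (\<lambda>z. covd G X z $ i $ i) y)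
      = (\<Sum>i\<in>UNIV. (\<Sum>k\<in>UNIV. riemann G i k i m y * X y $ k)
        + (\<Sum>j\<in>UNIV. christoffel G i m j y * covd G X y $ j $ i)
        - (\<Sum>j\<in>UNIV. christoffel G i i j y * covd G X y $ j $ m))"
      by (intro sum.cong refl ricci_identity X y)
    ultimately show ?thesis by (simp add: sum.distrib sum_subtractf)
  qed
  have "(\<Sum>m\<in>UNIV. ((\<Sum>i\<in>UNIV. pderiv_at i (\<lambda>z. covd G X z $ i $ m) y)
      + (\<Sum>i\<in>UNIV. \<Sum>j\<in>UNIV. ?C i i j y * ?N j m) - (\<Sum>i\<in>UNIV. \<Sum>j\<in>UNIV. ?N i j * ?C j i m y)) * ?x m)
     = (\<Sum>m\<in>UNIV. (pderiv_at m (divergence G X) y + (\<Sum>i\<in>UNIV. \<Sum>k\<in>UNIV. riemann G i k i m y * ?x k)) * ?x m)"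
    unfolding key ..
  moreover have "(\<Sum>m\<in>UNIV. (\<Sum>i\<in>UNIV. pderiv_at i (\<lambda>z. covd G X z $ i $ m) y) * ?x m)
      = (\<Sum>i\<in>UNIV. \<Sum>m\<in>UNIV. pderiv_at i (\<lambda>z. covd G X z $ i $ m) y * ?x m)"
    unfolding sum_distrib_right by (rule sum.swap)
  moreover have "(\<Sum>m\<in>UNIV. (\<Sum>i\<in>UNIV. \<Sum>j\<in>UNIV. ?C i i j y * ?N j m) * ?x m)
      = (\<Sum>i\<in>UNIV. \<Sum>j\<in>UNIV. \<Sum>m\<in>UNIV. ?C i i j y * ?N j m * ?x m)"
    unfolding sum_distrib_right by (rule trans[OF sum.swap], rule sum.cong[OF refl], rule sum.swap)
  moreover have "(\<Sum>m\<in>UNIV. (\<Sum>i\<in>UNIV. \<Sum>j\<in>UNIV. ?N i j * ?C j i m y) * ?x m)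
      = (\<Sum>i\<in>UNIV. \<Sum>j\<in>UNIV. \<Sum>m\<in>UNIV. ?N i j * ?C j i m y * ?x m)"
    unfolding sum_distrib_right by (rule trans[OF sum.swap], rule sum.cong[OF refl], rule sum.swap)
  ultimately show ?thesis unfolding L T R
    by (simp add: distrib_right left_diff_distrib sum.distrib sum_subtractf sum_distrib_right mult.commute[of "?x _" "pderiv_at _ _ _"])
qed

section \<open>Divergence, gradient, Laplacian and Hessian as differential operators\<close>

lemma divergence_cong:
  assumes "y \<in> V" "\<And>z. z \<in> V \<Longrightarrow> X z = Y z"
  shows "divergence G X y = divergence G Y y"
  unfolding divergence_def
  by (intro sum.cong refl arg_cong2[of _ _ _ _ "(+)"] pderiv_cong[OF open_V assms(1)]) (simp_all add: assms)

lemma divergence_add: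
  assumes "\<And>i. csmooth V (\<lambda>z. X z $ i)" "\<And>i. csmooth V (\<lambda>z. Y z $ i)" "y \<in> V"
  shows "divergence G (\<lambda>z. X z + Y z) y = divergence G X y + divergence G Y y"
  unfolding divergence_def by (simp add: pderiv_add[OF assms(1,2,3)] sum.distrib distrib_left)

lemma divergence_scale:
  assumes h: "csmooth V h" and X: "\<And>i. csmooth V (\<lambda>z. X z $ i)" and y: "y \<in> V"
  shows "divergence G (\<lambda>z. h z *\<^sub>R X z) y = h y * divergence G X y + (\<Sum>i\<in>UNIV. X y $ i * pderiv_at i h y)"
  unfolding divergence_def
  by (simp add: pderiv_mult[OF h X y] sum.distrib distrib_left sum_distrib_left mult_ac)

lemma grad_nth: "grad G f y $ i = (\<Sum>j\<in>UNIV. matrix_inv (G y) $ i $ j * pderiv_at j f y)"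
  by (simp add: grad_def matrix_vector_mult_def)

lemma csmooth_grad: "csmooth V f \<Longrightarrow> csmooth V (\<lambda>y. grad G f y $ i)"
  unfolding grad_nth by (intro csmooth_sum csmooth_mult csmooth_H csmooth_pderiv open_V)

lemma csmooth_divergence: "(\<And>i. csmooth V (\<lambda>z. X z $ i)) \<Longrightarrow> csmooth V (divergence G X)"
  unfolding divergence_eq_trace[abs_def] trace_def by (intro csmooth_sum csmooth_covd open_V)

lemma csmooth_laplace: "csmooth V f \<Longrightarrow> csmooth V (laplace_coord G f)"
  unfolding laplace_coord_def by (intro csmooth_divergence csmooth_grad)

lemma grad_cong: "y \<in> V \<Longrightarrow> (\<And>z. z \<in> V \<Longrightarrow> f z = h z) \<Longrightarrow> grad G f y = grad G h y"
  by (simp add: vec_eq_iff grad_nth cong: pderiv_cong[OF open_V])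

lemma laplace_cong: "y \<in> V \<Longrightarrow> (\<And>z. z \<in> V \<Longrightarrow> f z = h z) \<Longrightarrow> laplace_coord G f y = laplace_coord G h y"
  unfolding laplace_coord_def by (intro divergence_cong grad_cong)

lemma laplace_add:
  assumes "csmooth V f" "csmooth V h" "y \<in> V"
  shows "laplace_coord G (\<lambda>z. f z + h z) y = laplace_coord G f y + laplace_coord G h y"
proof -
  have "grad G (\<lambda>z. f z + h z) z = grad G f z + grad G h z" if "z \<in> V" for z
    by (simp add: vec_eq_iff grad_nth pderiv_add[OF assms(1,2) that] distrib_left sum.distrib)
  then have "laplace_coord G (\<lambda>z. f z + h z) y = divergence G (\<lambda>z. grad G f z + grad G h z) y"
    unfolding laplace_coord_def by (intro divergence_cong assms)
  then show ?thesis
    using divergence_add[OF csmooth_grad csmooth_grad, OF assms] by (simp add: laplace_coord_def)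
qed

lemma laplace_cmult:
  assumes "csmooth V f" "y \<in> V"
  shows "laplace_coord G (\<lambda>z. c * f z) y = c * laplace_coord G f y"
proof -
  have "grad G (\<lambda>z. c * f z) z = c *\<^sub>R grad G f z" if "z \<in> V" for z
    by (simp add: vec_eq_iff grad_nth pderiv_cmult[OF assms(1) that] sum_distrib_left mult_ac)
  then have "laplace_coord G (\<lambda>z. c * f z) y = divergence G (\<lambda>z. c *\<^sub>R grad G f z) y"
    unfolding laplace_coord_def by (intro divergence_cong assms)
  then show ?thesis
    using divergence_scale[OF csmooth_const[OF open_V] csmooth_grad[OF assms(1)] assms(2), of c]
    by (simp add: laplace_coord_def)
qed

lemma laplace_const [simp]: "laplace_coord G (\<lambda>_. c) y = 0"
proof -
  have "grad G (\<lambda>_. c) = (\<lambda>_. 0)" by (simp add: fun_eq_iff vec_eq_iff grad_nth)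
  then show ?thesis by (simp add: laplace_coord_def divergence_def)
qed

text \<open>Undoes the inverse matrix in \<open>grad\<close>. Differentiating this identity replaces
  differentiating the inverse metric.\<close>

lemma metric_mult_grad:
  assumes "y \<in> V" shows "(\<Sum>j\<in>UNIV. G y $ i $ j * grad G f y $ j) = pderiv_at i f y"
proof -
  have "(G y *v grad G f y) $ i = pderiv_at i f y"
    by (simp add: grad_def matrix_vector_mul_assoc matrix_inv_right[OF G_inv[OF assms]])
  then show ?thesis by (simp add: matrix_vector_mult_def)
qed

lemma metric_inner_grad:
  assumes "y \<in> V"
  shows "metric_inner G y v (grad G f y) = (\<Sum>i\<in>UNIV. v $ i * pderiv_at i f y)"
  by (simp add: metric_inner_def inner_vec_def matrix_vector_mult_def metric_mult_grad[OF assms])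

lemma csmooth_grad_norm:
  "csmooth V f \<Longrightarrow> csmooth V (\<lambda>y. metric_inner G y (grad G f y) (grad G f y))"
  by (rule csmooth_cong[of V "\<lambda>y. \<Sum>i\<in>UNIV. grad G f y $ i * pderiv_at i f y"])
     (auto simp: metric_inner_grad intro!: csmooth_sum csmooth_mult csmooth_grad csmooth_pderiv open_V)

text \<open>The gradient of the exponential is a scalar multiple of that of \<open>f\<close>, so
  \<open>divergence_scale\<close> applies. Used with c = 1 for u = exp w and with c = p - 1 for
  u^(p-1).\<close>

lemma laplace_exp:
  assumes f: "csmooth V f" and y: "y \<in> V"
  shows "laplace_coord G (\<lambda>z. exp (c * f z)) y =
    c * exp (c * f y) * (laplace_coord G f y + c * metric_inner G y (grad G f y) (grad G f y))"
proof -
  define h where "h z = c * exp (c * f z)" for z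
  have cf: "csmooth V (\<lambda>z. c * f z)" by (rule csmooth_cmult[OF f])
  have e: "csmooth V (\<lambda>z. exp (c * f z))" by (rule csmooth_exp[OF cf])
  have h: "csmooth V h" unfolding h_def by (rule csmooth_cmult[OF e])
  have p: "pderiv_at i (\<lambda>z. exp (c * f z)) z = h z * pderiv_at i f z" if "z \<in> V" for i z
    using ddir_chain(1)[where f="\<lambda>z. c * f z" and h=exp, OF csmooth_differentiable[OF cf that] DERIV_exp]
      pderiv_cmult[OF f that, of i c] by (simp add: pderiv_at_eq h_def)
  have ph: "pderiv_at i h y = c * (h y * pderiv_at i f y)" for i
    unfolding h_def[abs_def] using pderiv_cmult[OF e y, of i c] p[OF y, of i] by (simp add: h_def)
  have "grad G (\<lambda>z. exp (c * f z)) z = h z *\<^sub>R grad G f z" if "z \<in> V" for z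
    by (simp add: vec_eq_iff grad_nth p[OF that] sum_distrib_left mult_ac)
  then have "laplace_coord G (\<lambda>z. exp (c * f z)) y = divergence G (\<lambda>z. h z *\<^sub>R grad G f z) y"
    unfolding laplace_coord_def by (intro divergence_cong y)
  also have "\<dots> = h y * laplace_coord G f y + (\<Sum>i\<in>UNIV. grad G f y $ i * pderiv_at i h y)"
    using divergence_scale[OF h csmooth_grad[OF f] y] by (simp add: laplace_coord_def)
  also have "(\<Sum>i\<in>UNIV. grad G f y $ i * pderiv_at i h y)
      = c * h y * metric_inner G y (grad G f y) (grad G f y)"
    by (simp add: metric_inner_grad[OF y] ph sum_distrib_left mult_ac)
  finally show ?thesis by (simp add: h_def algebra_simps)
qed

text \<open>Differentiating \<open>metric_mult_grad\<close> trades derivatives of the gradient for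
  second derivatives of \<open>f\<close>. The sum is -2 times the Christoffel symbols of the first
  kind contracted with the gradient, so this is the usual Hessian; its symmetry now reduces to that
  of \<open>G\<close> and of second derivatives.\<close>

lemma hessian_eq:
  assumes f: "csmooth V f" and y: "y \<in> V"
  shows "(G y ** covd G (grad G f) y) $ k $ m = pderiv_at m (pderiv_at k f) y
    + (\<Sum>j\<in>UNIV. grad G f y $ j * (pderiv_at j (\<lambda>z. G z $ m $ k) y
        - pderiv_at m (\<lambda>z. G z $ j $ k) y - pderiv_at k (\<lambda>z. G z $ m $ j) y)) / 2"
proof -
  let ?X = "\<lambda>i. grad G f y $ i"
  have "pderiv_at m (\<lambda>z. \<Sum>i\<in>UNIV. G z $ k $ i * grad G f z $ i) y = pderiv_at m (pderiv_at k f) y"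
    by (rule pderiv_cong[OF open_V y]) (rule metric_mult_grad)
  then have 1: "(\<Sum>i\<in>UNIV. G y $ k $ i * pderiv_at m (\<lambda>z. grad G f z $ i) y)
      = pderiv_at m (pderiv_at k f) y - (\<Sum>i\<in>UNIV. pderiv_at m (\<lambda>z. G z $ k $ i) y * ?X i)"
    by (simp add: pderiv_sum[OF open_V y csmooth_mult[OF csmooth_G csmooth_grad[OF f]]]
        pderiv_mult[OF csmooth_G csmooth_grad[OF f] y] sum.distrib)
  have 2: "(\<Sum>i\<in>UNIV. G y $ k $ i * (\<Sum>j\<in>UNIV. christoffel G i m j y * ?X j))
      = (\<Sum>j\<in>UNIV. (\<Sum>i\<in>UNIV. G y $ k $ i * christoffel G i m j y) * ?X j)"
    unfolding sum_distrib_left sum_distrib_right by (rule trans[OF sum.swap]) (simp add: mult.assoc)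
  have "(G y ** covd G (grad G f) y) $ k $ m = pderiv_at m (pderiv_at k f) y
     + (\<Sum>j\<in>UNIV. (\<Sum>i\<in>UNIV. G y $ k $ i * christoffel G i m j y) * ?X j - pderiv_at m (\<lambda>z. G z $ k $ j) y * ?X j)"
    unfolding matrix_matrix_mult_def
    by (simp add: covd_nth distrib_left sum.distrib 1 2 sum_subtractf)
  also have "(\<Sum>j\<in>UNIV. (\<Sum>i\<in>UNIV. G y $ k $ i * christoffel G i m j y) * ?X j - pderiv_at m (\<lambda>z. G z $ k $ j) y * ?X j)
     = (\<Sum>j\<in>UNIV. ?X j * (pderiv_at j (\<lambda>z. G z $ m $ k) y
        - pderiv_at m (\<lambda>z. G z $ j $ k) y - pderiv_at k (\<lambda>z. G z $ m $ j) y)) / 2"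
    unfolding christoffel_lowered[OF y] sum_divide_distrib
    using pderiv_G_sym[OF y, of m k] by (intro sum.cong refl) (simp add: field_simps)
  finally show ?thesis .
qed

lemma hessian_sym:
  assumes f: "csmooth V f" and y: "y \<in> V"
  shows "transpose (G y ** covd G (grad G f) y) = G y ** covd G (grad G f) y"
proof -
  have "(G y ** covd G (grad G f) y) $ k $ m = (G y ** covd G (grad G f) y) $ m $ k" for k m
    unfolding hessian_eq[OF f y] pderiv_commute[OF f y, of m k]
    using pderiv_G_sym[OF y] by (simp add: algebra_simps)
  then show ?thesis by (simp add: vec_eq_iff transpose_def)
qed

text \<open>Compatibility of the connection with the metric combined with symmetry of the Hessian,
  verified in components.\<close>

lemma grad_grad_norm:
  assumes f: "csmooth V f" and y: "y \<in> V"
  shows "grad G (\<lambda>z. metric_inner G z (grad G f z) (grad G f z)) y = 2 *\<^sub>R (covd G (grad G f) y *v grad G f y)"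
proof -
  let ?X = "\<lambda>i. grad G f y $ i" and ?S = "G y ** covd G (grad G f) y"
  let ?dX = "\<lambda>k i. pderiv_at k (\<lambda>z. grad G f z $ i) y" and ?dG = "\<lambda>k i j. pderiv_at k (\<lambda>z. G z $ i $ j) y"
  have D: "pderiv_at k (\<lambda>z. metric_inner G z (grad G f z) (grad G f z)) y = 2 * (?S *v grad G f y) $ k" for k
  proof -
    have E: "(\<Sum>i\<in>UNIV. G y $ j $ i * ?dX k i) = pderiv_at k (pderiv_at j f) y - (\<Sum>i\<in>UNIV. ?dG k j i * ?X i)" for j
    proof -
      have "pderiv_at k (\<lambda>z. \<Sum>i\<in>UNIV. G z $ j $ i * grad G f z $ i) y = pderiv_at k (pderiv_at j f) y"
        by (rule pderiv_cong[OF open_V y]) (rule metric_mult_grad)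
      then show ?thesis
        by (simp add: pderiv_sum[OF open_V y csmooth_mult[OF csmooth_G csmooth_grad[OF f]]]
            pderiv_mult[OF csmooth_G csmooth_grad[OF f] y] sum.distrib)
    qed
    have "pderiv_at k (\<lambda>z. metric_inner G z (grad G f z) (grad G f z)) y
        = pderiv_at k (\<lambda>z. \<Sum>i\<in>UNIV. grad G f z $ i * pderiv_at i f z) y"
      by (rule pderiv_cong[OF open_V y]) (rule metric_inner_grad)
    also have "\<dots> = (\<Sum>i\<in>UNIV. ?dX k i * pderiv_at i f y) + (\<Sum>i\<in>UNIV. ?X i * pderiv_at k (pderiv_at i f) y)"
      by (simp add: pderiv_sum[OF open_V y csmooth_mult[OF csmooth_grad csmooth_pderiv, OF f f]]
        pderiv_mult[OF csmooth_grad csmooth_pderiv, OF f f y] sum.distrib)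
    also have "(\<Sum>i\<in>UNIV. ?dX k i * pderiv_at i f y) = (\<Sum>j\<in>UNIV. ?X j * (\<Sum>i\<in>UNIV. G y $ j $ i * ?dX k i))"
      unfolding metric_mult_grad[OF y, of _ f, symmetric] sum_distrib_left
      by (rule trans[OF sum.swap]) (simp add: G_nth_sym[OF y, of _ j for j] mult_ac)
    also have "(\<Sum>j\<in>UNIV. ?X j * (\<Sum>i\<in>UNIV. G y $ j $ i * ?dX k i))
        = (\<Sum>j\<in>UNIV. ?X j * (pderiv_at k (pderiv_at j f) y - (\<Sum>i\<in>UNIV. ?dG k j i * ?X i)))"
      unfolding E ..
    finally have L: "pderiv_at k (\<lambda>z. metric_inner G z (grad G f z) (grad G f z)) y
       = 2 * (\<Sum>j\<in>UNIV. ?X j * pderiv_at k (pderiv_at j f) y) - (\<Sum>j\<in>UNIV. \<Sum>i\<in>UNIV. ?X j * (?dG k j i * ?X i))"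
      by (simp add: right_diff_distrib sum_subtractf sum_distrib_left)
    have "2 * (?S *v grad G f y) $ k = (\<Sum>m\<in>UNIV. 2 * ?S $ k $ m * ?X m)"
      by (simp add: matrix_vector_mult_def sum_distrib_left mult.assoc)
    also have "\<dots> = (\<Sum>m\<in>UNIV. 2 * (?X m * pderiv_at k (pderiv_at m f) y)
        + (\<Sum>j\<in>UNIV. ?X j * ?X m * ?dG j m k - ?X j * ?X m * ?dG m j k - ?X j * ?X m * ?dG k m j))"
    proof (rule sum.cong[OF refl])
      fix m
      have "2 * (a + b / 2) * x = 2 * (x * a) + b * x" for a b x :: real by (simp add: field_simps)
      then show "2 * ?S $ k $ m * ?X m = 2 * (?X m * pderiv_at k (pderiv_at m f) y)
        + (\<Sum>j\<in>UNIV. ?X j * ?X m * ?dG j m k - ?X j * ?X m * ?dG m j k - ?X j * ?X m * ?dG k m j)"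
        unfolding hessian_eq[OF f y] pderiv_commute[OF f y, of k]
        by (simp add: sum_distrib_right algebra_simps) (simp add: sum_distrib_left algebra_simps)
    qed
    also have "\<dots> = 2 * (\<Sum>m\<in>UNIV. ?X m * pderiv_at k (pderiv_at m f) y)
        - (\<Sum>m\<in>UNIV. \<Sum>j\<in>UNIV. ?X j * ?X m * ?dG k m j)
        + ((\<Sum>m\<in>UNIV. \<Sum>j\<in>UNIV. ?X j * ?X m * ?dG j m k) - (\<Sum>m\<in>UNIV. \<Sum>j\<in>UNIV. ?X j * ?X m * ?dG m j k))"
      by (simp add: sum.distrib sum_subtractf sum_distrib_left)
    \<comment> \<open>The remaining metric derivatives are antisymmetric in \<open>j\<close> and
      \<open>m\<close> but meet a symmetric product of gradient components, so the two sums
      agree.\<close>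
    also have "(\<Sum>m\<in>UNIV. \<Sum>j\<in>UNIV. ?X j * ?X m * ?dG j m k) = (\<Sum>m\<in>UNIV. \<Sum>j\<in>UNIV. ?X j * ?X m * ?dG m j k)"
      by (rule trans[OF sum.swap]) (simp add: mult_ac)
    finally show ?thesis unfolding L by (simp add: mult_ac)
  qed
  have "grad G (\<lambda>z. metric_inner G z (grad G f z) (grad G f z)) y
      = matrix_inv (G y) *v (2 *\<^sub>R (?S *v grad G f y))"
    unfolding grad_def[of G "\<lambda>z. metric_inner G z (grad G f z) (grad G f z)"] D
    by (rule arg_cong[where f="\<lambda>x. _ *v x"]) (simp add: vec_eq_iff)
  also have "\<dots> = 2 *\<^sub>R (matrix_inv (G y) ** G y ** covd G (grad G f) y *v grad G f y)"
    by (simp add: matrix_vector_mult_scaleR matrix_vector_mul_assoc matrix_mul_assoc)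
  finally show ?thesis by (simp add: matrix_inv_left[OF G_inv[OF y]])
qed

lemma bochner:
  assumes f: "csmooth V f" and y: "y \<in> V"
  shows "laplace_coord G (\<lambda>z. metric_inner G z (grad G f z) (grad G f z)) y =
    2 * (\<Sum>m\<in>UNIV. grad G f y $ m * pderiv_at m (laplace_coord G f) y)
    + 2 * ricci G y (grad G f y) (grad G f y)
    + 2 * trace (covd G (grad G f) y ** covd G (grad G f) y)"
proof -
  let ?Y = "\<lambda>z. covd G (grad G f) z *v grad G f z"
  have Y: "csmooth V (\<lambda>z. ?Y z $ i)" for i
    unfolding matrix_vector_mult_def
    by (simp add: csmooth_sum csmooth_mult csmooth_covd csmooth_grad f open_V)
  have "laplace_coord G (\<lambda>z. metric_inner G z (grad G f z) (grad G f z)) y = divergence G (\<lambda>z. 2 *\<^sub>R ?Y z) y"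
    unfolding laplace_coord_def by (intro divergence_cong y grad_grad_norm f)
  also have "\<dots> = 2 * divergence G ?Y y"
    using divergence_scale[OF csmooth_const[OF open_V] Y y, of 2] by simp
  also have "divergence G ?Y y = (\<Sum>m\<in>UNIV. grad G f y $ m * pderiv_at m (laplace_coord G f) y)
    + ricci G y (grad G f y) (grad G f y) + trace (covd G (grad G f) y ** covd G (grad G f) y)"
    using divergence_covd_self[OF csmooth_grad[OF f] y] by (simp add: laplace_coord_def)
  finally show ?thesis by simp
qed

lemma trace_hessian_square_ge:
  assumes f: "csmooth V f" and y: "y \<in> V"
  shows "trace (covd G (grad G f) y ** covd G (grad G f) y) \<ge> (laplace_coord G f y)\<^sup>2 / real CARD('n)"
  using trace_square_ge[OF G_pos'[OF y] G_sym[OF y] hessian_sym[OF f y]]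
  by (simp add: laplace_coord_def divergence_eq_trace)

text \<open>At a critical point all first order terms vanish and the Laplacian is the pairing of the
  inverse metric with the matrix of second partial derivatives. The former is positive and the
  latter negative semidefinite, by the second derivatives along lines.\<close>

lemma laplace_max:
  assumes f: "csmooth V f" and y: "y \<in> V" and max: "\<And>z. z \<in> V \<Longrightarrow> f z \<le> f y"
  shows "pderiv_at i f y = 0" and "laplace_coord G f y \<le> 0"
proof -
  have z: "pderiv_at k f y = 0" for k
    unfolding pderiv_at_eq by (rule local_max_directional[OF f y max])
  then show "pderiv_at i f y = 0" .
  define B where "B = (\<chi> i j. - pderiv_at i (pderiv_at j f) y)"
  have B: "v \<bullet> (B *v v) \<ge> 0" for v
  proof -
    have E: "pderiv_at k (ddir v f) y = (\<Sum>j\<in>UNIV. v $ j * pderiv_at k (pderiv_at j f) y)" for k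
    proof -
      have "pderiv_at k (ddir v f) y = pderiv_at k (\<lambda>z. \<Sum>j\<in>UNIV. v $ j * pderiv_at j f z) y"
        by (rule pderiv_cong[OF open_V y]) (rule ddir_expand[OF csmooth_differentiable[OF f]])
      then show ?thesis
        by (simp add: pderiv_sum[OF open_V y csmooth_cmult[OF csmooth_pderiv[OF f]]]
            pderiv_cmult[OF csmooth_pderiv[OF f] y])
    qed
    have "ddir v (ddir v f) y = (\<Sum>i\<in>UNIV. v $ i * pderiv_at i (ddir v f) y)"
      by (rule ddir_expand[OF csmooth_differentiable[OF csmooth_ddir[OF f] y]])
    also have "\<dots> = (\<Sum>i\<in>UNIV. v $ i * (\<Sum>j\<in>UNIV. v $ j * pderiv_at i (pderiv_at j f) y))"
      unfolding E ..
    finally have "ddir v (ddir v f) y = - (v \<bullet> (B *v v))"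
      by (simp add: B_def inner_vec_def matrix_vector_mult_def sum_negf mult.commute)
    then show ?thesis using local_max_directional(2)[OF f y max, of v] by simp
  qed
  have g0: "grad G f y $ j = 0" for j by (simp add: grad_nth z)
  have "laplace_coord G f y = (\<Sum>i\<in>UNIV. \<Sum>j\<in>UNIV. matrix_inv (G y) $ i $ j * pderiv_at i (pderiv_at j f) y)"
    unfolding laplace_coord_def divergence_def g0 unfolding grad_nth
    by (simp add: pderiv_sum[OF open_V y csmooth_mult[OF csmooth_H csmooth_pderiv[OF f]]]
        pderiv_mult[OF csmooth_H csmooth_pderiv[OF f] y] z)
  also have "\<dots> = - (\<Sum>i\<in>UNIV. \<Sum>j\<in>UNIV. matrix_inv (G y) $ i $ j * B $ i $ j)"
    by (simp add: B_def sum_negf)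
  also have "\<dots> \<le> 0"
    using psd_pairing_nonneg[OF H_sym[OF y] matrix_inv_psd[OF G_pos'[OF y] G_sym[OF y]] B] by simp
  finally show "laplace_coord G f y \<le> 0" .
qed

end

subsection \<open>Invariance under change of charts\<close>

lemma ddir_compose:
  fixes \<phi> :: "'a::real_normed_vector \<Rightarrow> real^'n" and h :: "real^'n \<Rightarrow> real"
  assumes phi: "csmooth U \<phi>" and h: "csmooth W h" and y: "y \<in> U" "\<phi> y \<in> W"
  shows "(\<lambda>z. h (\<phi> z)) differentiable (at y)"
    and "ddir v (\<lambda>z. h (\<phi> z)) y = (\<Sum>a\<in>UNIV. ddir v (\<lambda>z. \<phi> z $ a) y * pderiv_at a h (\<phi> y))"
proof -
  have d: "((\<lambda>z. h (\<phi> z)) has_derivative (\<lambda>v. ddir (ddir v \<phi> y) h (\<phi> y))) (at y)"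
    by (rule has_derivative_compose[OF csmooth_has_derivative[OF phi y(1)]])
       (rule csmooth_has_derivative[OF h y(2)])
  then show "(\<lambda>z. h (\<phi> z)) differentiable (at y)" by (auto simp: differentiable_def)
  show "ddir v (\<lambda>z. h (\<phi> z)) y = (\<Sum>a\<in>UNIV. ddir v (\<lambda>z. \<phi> z $ a) y * pderiv_at a h (\<phi> y))"
    by (simp add: ddir_eq[OF d] ddir_expand[OF csmooth_differentiable[OF h y(2)]]
        ddir_bounded_linear[OF bounded_linear_vec_nth csmooth_differentiable[OF phi y(1)]])
qed

text \<open>By the chain rule, a derivative of the composite is a sum of derivatives of components
  of \<open>\<phi>\<close> times composites of partial derivatives of \<open>h\<close>; the latter
  fall under the induction hypothesis, whence \<open>h\<close> is arbitrary.\<close>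

lemma csmooth_compose:
  fixes \<phi> :: "'a::real_normed_vector \<Rightarrow> real^'n" and h :: "real^'n \<Rightarrow> real"
  assumes phi: "csmooth U \<phi>" and h: "csmooth W h" and sub: "\<And>y. y \<in> U \<Longrightarrow> \<phi> y \<in> W"
  shows "csmooth U (\<lambda>y. h (\<phi> y))"
proof -
  note o = csmooth_open[OF phi]
  have comp: "csmooth U (\<lambda>z. \<phi> z $ a)" for a
    by (rule csmooth_bounded_linear[OF bounded_linear_vec_nth phi])
  have "higher_differentiable_on n U (\<lambda>y. h (\<phi> y))" for n
    using h
  proof (induction n arbitrary: h)
    case 0
    then show ?case
      using continuous_on_compose2[OF csmooth_continuous[OF 0] csmooth_continuous[OF phi]] sub by auto
  next
    case (Suc n)
    \<comment> \<open>The composites are known to be differentiable to order \<open>n\<close> only,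
      so instead of \<open>csmooth_sum\<close> an induction on the index set at this fixed order is
      used.\<close>
    have "higher_differentiable_on n U (\<lambda>y. \<Sum>a\<in>I. ddir v (\<lambda>z. \<phi> z $ a) y * pderiv_at a h (\<phi> y))"
      for v and I :: "'n set"
    proof (induction I rule: infinite_finite_induct)
      case (insert a I)
      then show ?case
        using hdo_add[OF o hdo_mult[OF o _ Suc.IH[OF csmooth_pderiv[OF Suc.prems]]] insert.IH]
          csmooth_ddir[OF comp] by (simp add: csmooth_def)
    qed (simp_all add: hdo_const)
    from hdo_cong[OF o _ this[of _ UNIV]]
    have "higher_differentiable_on n U (ddir v (\<lambda>y. h (\<phi> y)))" for v
      using ddir_compose(2)[OF phi Suc.prems _ sub] by simp
    then show ?case unfolding hdo_Suc using ddir_compose(1)[OF phi Suc.prems _ sub] by blast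
  qed
  then show ?thesis using o by (simp add: csmooth_def)
qed

lemma invertible_left_cancel:
  assumes "invertible A" "A ** X = A ** Y"
  shows "X = Y"
proof -
  have "X = matrix_inv A ** (A ** X)" for X
    by (simp add: matrix_mul_assoc matrix_inv_left[OF assms(1)])
  from this[of X] this[of Y] show ?thesis by (simp add: assms(2))
qed

lemma sum_rotate3:
  "(\<Sum>a\<in>A. \<Sum>b\<in>B. \<Sum>c\<in>C. F a b c) = (\<Sum>b\<in>B. \<Sum>c\<in>C. \<Sum>a\<in>A. F a b c)"
  by (rule trans[OF sum.swap], rule sum.cong[OF refl], rule sum.swap)

lemma sum_rotate4:
  "(\<Sum>a\<in>A. \<Sum>b\<in>B. \<Sum>c\<in>C. \<Sum>d\<in>D. F a b c d) = (\<Sum>b\<in>B. \<Sum>c\<in>C. \<Sum>d\<in>D. \<Sum>a\<in>A. F a b c d)"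
  by (rule trans[OF sum.swap], rule sum.cong[OF refl], rule sum_rotate3)

text \<open>A transition map enters only as a smooth map that preserves inner products;
  invertibility of its Jacobian follows from positivity of \<open>G\<close>.\<close>

locale chart_change = src: local_metric U G + tgt: local_metric W M
  for U :: "(real^'n::finite) set" and G W M +
  fixes \<phi> :: "real^'n \<Rightarrow> real^'n"
  assumes phi: "csmooth U \<phi>"
    and phi_in: "y \<in> U \<Longrightarrow> \<phi> y \<in> W"
    and isometry: "y \<in> U \<Longrightarrow> metric_inner G y v w =
      metric_inner M (\<phi> y) (frechet_derivative \<phi> (at y) v) (frechet_derivative \<phi> (at y) w)"
begin

definition jac :: "'n \<Rightarrow> 'n \<Rightarrow> real^'n \<Rightarrow> real" where
  "jac a k = pderiv_at k (\<lambda>z. \<phi> z $ a)"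

definition jac_matrix :: "real^'n \<Rightarrow> real^'n^'n" where
  "jac_matrix y = (\<chi> a k. jac a k y)"

lemma csmooth_phi_nth: "csmooth U (\<lambda>z. \<phi> z $ a)"
  by (rule csmooth_bounded_linear[OF bounded_linear_vec_nth phi])

lemma csmooth_jac: "csmooth U (jac a k)"
  unfolding jac_def by (intro csmooth_pderiv csmooth_phi_nth)

lemma pderiv_jac_sym: "y \<in> U \<Longrightarrow> pderiv_at m (jac a k) y = pderiv_at k (jac a m) y"
  unfolding jac_def by (rule pderiv_commute[OF csmooth_phi_nth])

lemma pderiv_chain:
  "csmooth W h \<Longrightarrow> y \<in> U \<Longrightarrow>
    pderiv_at k (\<lambda>z. h (\<phi> z)) y = (\<Sum>a\<in>UNIV. jac a k y * pderiv_at a h (\<phi> y))"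
  unfolding pderiv_at_eq[where i=k] jac_def by (rule ddir_compose(2)[OF phi _ _ phi_in])

lemma csmooth_comp:
  fixes h :: "real^'n \<Rightarrow> real"
  shows "csmooth W h \<Longrightarrow> csmooth U (\<lambda>z. h (\<phi> z))"
  using csmooth_compose phi phi_in by blast

lemma frechet_jac: "y \<in> U \<Longrightarrow> frechet_derivative \<phi> (at y) v = jac_matrix y *v v"
proof -
  assume y: "y \<in> U"
  have "frechet_derivative \<phi> (at y) v $ a = ddir v (\<lambda>z. \<phi> z $ a) y" for a
    using ddir_bounded_linear[OF bounded_linear_vec_nth csmooth_differentiable[OF phi y], of v a]
    by (simp add: ddir_def)
  then show ?thesis
    using ddir_expand[OF csmooth_differentiable[OF csmooth_phi_nth y], of v]
    by (simp add: vec_eq_iff matrix_vector_mult_def jac_matrix_def jac_def mult.commute)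
qed

lemma isometry_jac:
  "y \<in> U \<Longrightarrow> v \<bullet> (G y *v w) = (jac_matrix y *v v) \<bullet> (M (\<phi> y) *v (jac_matrix y *v w))"
  using isometry[of y v w] by (simp add: frechet_jac metric_inner_def)

lemma jac_invertible: "y \<in> U \<Longrightarrow> invertible (jac_matrix y)"
proof -
  assume y: "y \<in> U"
  have "v = 0" if "jac_matrix y *v v = 0" for v
    using isometry_jac[OF y, of v v] src.G_pos'[OF y, of v] that by force
  then show ?thesis using matrix_left_invertible_ker[of "jac_matrix y"] invertible_left_inverse by blast
qed

lemma metric_nth:
  assumes "y \<in> U"
  shows "G y $ m $ k = (\<Sum>a\<in>UNIV. \<Sum>b\<in>UNIV. jac a m y * M (\<phi> y) $ a $ b * jac b k y)"
proof -
  have "G y $ m $ k = axis m 1 \<bullet> (G y *v axis k 1)"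
    by (simp add: inner_axis' matrix_vector_axis)
  also have "\<dots> = (\<Sum>a\<in>UNIV. \<Sum>b\<in>UNIV. jac a m y * M (\<phi> y) $ a $ b * jac b k y)"
    unfolding isometry_jac[OF assms]
    by (simp add: inner_vec_def matrix_vector_axis matrix_vector_mult_def[of "M (\<phi> y)"]
        jac_matrix_def sum_distrib_left mult.assoc)
  finally show ?thesis .
qed

lemma congruence_nth:
  "(transpose (jac_matrix y) ** S ** jac_matrix y) $ k $ m
    = (\<Sum>a\<in>UNIV. \<Sum>b\<in>UNIV. jac a k y * S $ a $ b * jac b m y)"
proof -
  have "(transpose (jac_matrix y) ** S ** jac_matrix y) $ k $ m
      = (\<Sum>b\<in>UNIV. \<Sum>a\<in>UNIV. jac a k y * S $ a $ b * jac b m y)"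
    by (simp add: matrix_matrix_mult_def transpose_def jac_matrix_def sum_distrib_right)
  also note sum.swap
  finally show ?thesis .
qed

lemma metric_matrix: "y \<in> U \<Longrightarrow> G y = transpose (jac_matrix y) ** M (\<phi> y) ** jac_matrix y"
  by (simp add: vec_eq_iff metric_nth congruence_nth)

context
  fixes f h :: "real^'n \<Rightarrow> real"
  assumes f: "csmooth U f" and h: "csmooth W h" and fh: "\<And>y. y \<in> U \<Longrightarrow> f y = h (\<phi> y)"
begin

lemma pderiv_comp: "y \<in> U \<Longrightarrow> pderiv_at k f y = (\<Sum>a\<in>UNIV. jac a k y * pderiv_at a h (\<phi> y))"
  by (simp add: pderiv_chain[OF h, symmetric] pderiv_cong[OF src.open_V _ fh])

text \<open>With J the Jacobian, G = J^T M J and df = J^T dh. Cancelling J^T and then M shows that J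
  pushes the gradient forward.\<close>

lemma grad_comp:
  assumes y: "y \<in> U" shows "jac_matrix y *v grad G f y = grad M h (\<phi> y)"
proof -
  let ?J = "jac_matrix y"
  define d where "d = (\<chi> a. pderiv_at a h (\<phi> y))"
  have df: "(\<chi> i. pderiv_at i f y) = transpose ?J *v d"
    by (simp add: vec_eq_iff d_def matrix_vector_mult_def transpose_def jac_matrix_def pderiv_comp[OF y])
  have "G y *v grad G f y = transpose ?J *v d"
    by (simp add: grad_def df matrix_vector_mul_assoc matrix_mul_assoc matrix_inv_right[OF src.G_inv[OF y]])
  then have "transpose ?J *v (M (\<phi> y) *v (?J *v grad G f y)) = transpose ?J *v d"
    by (simp add: metric_matrix[OF y] matrix_vector_mul_assoc matrix_mul_assoc)
  moreover have "invertible (transpose ?J)"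
    using jac_invertible[OF y] by (simp add: invertible_det_nz det_transpose)
  ultimately have "M (\<phi> y) *v (?J *v grad G f y) = d"
    by (metis matrix_inv_left matrix_vector_mul_assoc matrix_vector_mul_lid)
  then have "matrix_inv (M (\<phi> y)) *v (M (\<phi> y) *v (?J *v grad G f y)) = grad M h (\<phi> y)"
    by (simp add: grad_def d_def)
  then show ?thesis
    by (simp add: matrix_vector_mul_assoc matrix_mul_assoc matrix_inv_left[OF tgt.G_inv[OF phi_in[OF y]]])
qed

lemma grad_comp_nth:
  "y \<in> U \<Longrightarrow> (\<Sum>j\<in>UNIV. jac a j y * grad G f y $ j) = grad M h (\<phi> y) $ a"
  using arg_cong[OF grad_comp, of y "\<lambda>v. v $ a"] by (simp add: matrix_vector_mult_def jac_matrix_def)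

lemma grad_norm_comp:
  "y \<in> U \<Longrightarrow> metric_inner G y (grad G f y) (grad G f y)
      = metric_inner M (\<phi> y) (grad M h (\<phi> y)) (grad M h (\<phi> y))"
  using isometry[of y "grad G f y" "grad G f y"] by (simp add: frechet_jac grad_comp)

text \<open>The second derivatives of \<open>\<phi>\<close> cancel between the derivatives of \<open>f\<close> and of the metric.\<close>

lemma hessian_comp:
  assumes y: "y \<in> U"
  shows "(G y ** covd G (grad G f) y) $ k $ m =
    (\<Sum>a\<in>UNIV. \<Sum>b\<in>UNIV. jac a k y * jac b m y * (M (\<phi> y) ** covd M (grad M h) (\<phi> y)) $ a $ b)"
proof -
  let ?X = "\<lambda>j. grad G f y $ j" and ?Y = "\<lambda>c. grad M h (\<phi> y) $ c"
  let ?J = "\<lambda>a k. jac a k y" and ?P = "\<lambda>a m k. pderiv_at m (jac a k) y"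
  let ?M = "\<lambda>a b. M (\<phi> y) $ a $ b" and ?dM = "\<lambda>c a b. pderiv_at c (\<lambda>z. M z $ a $ b) (\<phi> y)"
  let ?dh = "\<lambda>a. pderiv_at a h (\<phi> y)" and ?ddh = "\<lambda>b a. pderiv_at b (pderiv_at a h) (\<phi> y)"
  have w: "\<phi> y \<in> W" by (rule phi_in[OF y])
  have Msym: "?M a b = ?M b a" for a b by (rule tgt.G_nth_sym[OF w])
  \<comment> \<open>In the derivative of the metric, \<open>al\<close> collects the terms in which a
    Jacobian factor is differentiated, \<open>D\<close> those in which an entry of \<open>M\<close>
    is.\<close>
  define al where "al j m k = (\<Sum>a\<in>UNIV. \<Sum>b\<in>UNIV. ?P a j m * ?M a b * ?J b k)" for j m k
  define D where "D j m k = (\<Sum>a\<in>UNIV. \<Sum>b\<in>UNIV. \<Sum>c\<in>UNIV. ?J a m * ?J b k * ?J c j * ?dM c a b)" for j m k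
  have al_sym: "al j m k = al m j k" for j m k
    unfolding al_def pderiv_jac_sym[OF y, of j _ m] ..
  have al_swap: "al j k m = (\<Sum>a\<in>UNIV. \<Sum>b\<in>UNIV. ?J a m * ?M a b * ?P b j k)" for j m k
    unfolding al_def by (rule trans[OF sum.swap]) (simp add: Msym mult_ac)
  have dG: "pderiv_at j (\<lambda>z. G z $ m $ k) y = al j m k + D j m k + al j k m" for j m k
  proof -
    note cM = csmooth_comp[OF tgt.csmooth_G]
    have prod_rule: "pderiv_at j (\<lambda>z. jac a m z * M (\<phi> z) $ a $ b * jac b k z) y = ?P a j m * ?M a b * ?J b k
        + (\<Sum>c\<in>UNIV. ?J a m * ?J b k * ?J c j * ?dM c a b) + ?J a m * ?M a b * ?P b j k" for a b
      unfolding pderiv_mult[OF csmooth_mult[OF csmooth_jac cM] csmooth_jac y] pderiv_mult[OF csmooth_jac cM y]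
        pderiv_chain[OF tgt.csmooth_G y]
      by (simp add: distrib_left distrib_right sum_distrib_left sum_distrib_right mult_ac)
    have "pderiv_at j (\<lambda>z. G z $ m $ k) y =
        pderiv_at j (\<lambda>z. \<Sum>a\<in>UNIV. \<Sum>b\<in>UNIV. jac a m z * M (\<phi> z) $ a $ b * jac b k z) y"
      by (rule pderiv_cong[OF src.open_V y]) (rule metric_nth)
    also have "\<dots> = (\<Sum>a\<in>UNIV. \<Sum>b\<in>UNIV. ?P a j m * ?M a b * ?J b k
        + (\<Sum>c\<in>UNIV. ?J a m * ?J b k * ?J c j * ?dM c a b) + ?J a m * ?M a b * ?P b j k)"
      by (simp add: pderiv_sum[OF src.open_V y] csmooth_sum src.open_V csmooth_mult csmooth_jac cM prod_rule)
    finally show ?thesis unfolding al_swap[where j=j and k=k and m=m] by (simp add: al_def D_def sum.distrib)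
  qed
  have ddf: "pderiv_at m (pderiv_at k f) y = (\<Sum>a\<in>UNIV. ?P a m k * ?dh a)
      + (\<Sum>a\<in>UNIV. \<Sum>b\<in>UNIV. ?J a k * ?J b m * ?ddh b a)"
  proof -
    note ch = csmooth_comp[OF csmooth_pderiv[OF h]]
    have "pderiv_at m (pderiv_at k f) y = pderiv_at m (\<lambda>z. \<Sum>a\<in>UNIV. jac a k z * pderiv_at a h (\<phi> z)) y"
      by (rule pderiv_cong[OF src.open_V y]) (rule pderiv_comp)
    then show ?thesis
      by (simp add: pderiv_sum[OF src.open_V y csmooth_mult[OF csmooth_jac ch]]
          pderiv_mult[OF csmooth_jac ch y] pderiv_chain[OF csmooth_pderiv[OF h] y] sum.distrib
          sum_distrib_left mult.assoc)
  qed
  \<comment> \<open>Contracted with the gradient, \<open>al\<close> becomes exactly the term with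
    second derivatives of \<open>\<phi>\<close> in \<open>ddf\<close>.\<close>
  have Xal: "(\<Sum>j\<in>UNIV. ?X j * al m k j) = (\<Sum>a\<in>UNIV. ?P a m k * ?dh a)"
  proof -
    have "(\<Sum>j\<in>UNIV. ?X j * al m k j)
        = (\<Sum>a\<in>UNIV. \<Sum>b\<in>UNIV. \<Sum>j\<in>UNIV. ?P a m k * ?M a b * (?J b j * ?X j))"
      unfolding al_def sum_distrib_left by (rule trans[OF sum_rotate3]) (simp add: mult_ac)
    also have "\<dots> = (\<Sum>a\<in>UNIV. \<Sum>b\<in>UNIV. ?P a m k * ?M a b * ?Y b)"
      unfolding sum_distrib_left[symmetric] grad_comp_nth[OF y] ..
    also have "\<dots> = (\<Sum>a\<in>UNIV. ?P a m k * ?dh a)"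
      by (simp add: tgt.metric_mult_grad[OF w, symmetric] sum_distrib_left mult.assoc)
    finally show ?thesis .
  qed
  \<comment> \<open>In this and the next two sums the Jacobian factor with index \<open>j\<close>
    turns the gradient of \<open>f\<close> into that of \<open>h\<close>; they differ in the slot of
    the differentiated metric that receives it.\<close>
  have XD1: "(\<Sum>j\<in>UNIV. ?X j * D j m k) = (\<Sum>a\<in>UNIV. \<Sum>b\<in>UNIV. ?J a k * ?J b m * (\<Sum>c\<in>UNIV. ?Y c * ?dM c b a))"
  proof -
    have "(\<Sum>j\<in>UNIV. ?X j * D j m k)
        = (\<Sum>b\<in>UNIV. \<Sum>a\<in>UNIV. \<Sum>c\<in>UNIV. \<Sum>j\<in>UNIV. ?J a k * ?J b m * (?J c j * ?X j) * ?dM c b a)"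
      unfolding D_def sum_distrib_left
      by (rule trans[OF sum_rotate4]) (simp add: mult_ac)
    also have "\<dots> = (\<Sum>b\<in>UNIV. \<Sum>a\<in>UNIV. \<Sum>c\<in>UNIV. ?J a k * ?J b m * ?Y c * ?dM c b a)"
      unfolding sum_distrib_left[symmetric] sum_distrib_right[symmetric] grad_comp_nth[OF y] ..
    also note sum.swap
    finally show ?thesis by (simp add: sum_distrib_left mult.assoc)
  qed
  have XD2: "(\<Sum>j\<in>UNIV. ?X j * D m j k) = (\<Sum>a\<in>UNIV. \<Sum>b\<in>UNIV. ?J a k * ?J b m * (\<Sum>c\<in>UNIV. ?Y c * ?dM b c a))"
  proof -
    have "(\<Sum>j\<in>UNIV. ?X j * D m j k)
        = (\<Sum>c\<in>UNIV. \<Sum>a\<in>UNIV. \<Sum>b\<in>UNIV. \<Sum>j\<in>UNIV. ?J a k * ?J b m * (?J c j * ?X j) * ?dM b c a)"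
      unfolding D_def sum_distrib_left
      by (rule trans[OF sum_rotate4]) (simp add: mult_ac)
    also have "\<dots> = (\<Sum>c\<in>UNIV. \<Sum>a\<in>UNIV. \<Sum>b\<in>UNIV. ?J a k * ?J b m * ?Y c * ?dM b c a)"
      unfolding sum_distrib_left[symmetric] sum_distrib_right[symmetric] grad_comp_nth[OF y] ..
    also note sum_rotate3
    finally show ?thesis by (simp add: sum_distrib_left mult.assoc)
  qed
  have XD3: "(\<Sum>j\<in>UNIV. ?X j * D k m j) = (\<Sum>a\<in>UNIV. \<Sum>b\<in>UNIV. ?J a k * ?J b m * (\<Sum>c\<in>UNIV. ?Y c * ?dM a b c))"
  proof -
    have "(\<Sum>j\<in>UNIV. ?X j * D k m j)
        = (\<Sum>b\<in>UNIV. \<Sum>c\<in>UNIV. \<Sum>a\<in>UNIV. \<Sum>j\<in>UNIV. ?J a k * ?J b m * (?J c j * ?X j) * ?dM a b c)"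
      unfolding D_def sum_distrib_left
      by (rule trans[OF sum_rotate4]) (simp add: mult_ac)
    also have "\<dots> = (\<Sum>b\<in>UNIV. \<Sum>c\<in>UNIV. \<Sum>a\<in>UNIV. ?J a k * ?J b m * ?Y c * ?dM a b c)"
      unfolding sum_distrib_left[symmetric] sum_distrib_right[symmetric] grad_comp_nth[OF y] ..
    also note sum_rotate3[symmetric]
    finally show ?thesis by (simp add: sum_distrib_left mult.assoc)
  qed
  have "(\<Sum>j\<in>UNIV. ?X j * (pderiv_at j (\<lambda>z. G z $ m $ k) y
        - pderiv_at m (\<lambda>z. G z $ j $ k) y - pderiv_at k (\<lambda>z. G z $ m $ j) y))
      = (\<Sum>j\<in>UNIV. ?X j * D j m k - ?X j * D m j k - ?X j * D k m j - 2 * (?X j * al m k j))"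
  \<comment> \<open>Of the six occurrences of \<open>al\<close>, four cancel in pairs by
    \<open>al_sym\<close> and the other two add up.\<close>
  proof (rule sum.cong[OF refl])
    fix j
    have "al j m k = al m j k" "al j k m = al k j m" "al k m j = al m k j" by (rule al_sym)+
    then show "?X j * (pderiv_at j (\<lambda>z. G z $ m $ k) y
        - pderiv_at m (\<lambda>z. G z $ j $ k) y - pderiv_at k (\<lambda>z. G z $ m $ j) y)
      = ?X j * D j m k - ?X j * D m j k - ?X j * D k m j - 2 * (?X j * al m k j)"
      unfolding dG by (simp add: algebra_simps)
  qed
  also have "\<dots> = (\<Sum>j\<in>UNIV. ?X j * D j m k) - (\<Sum>j\<in>UNIV. ?X j * D m j k)
      - (\<Sum>j\<in>UNIV. ?X j * D k m j) - 2 * (\<Sum>j\<in>UNIV. ?X j * al m k j)"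
    by (simp add: sum_subtractf sum_distrib_left)
  finally have sumX: "(\<Sum>j\<in>UNIV. ?X j * (pderiv_at j (\<lambda>z. G z $ m $ k) y
        - pderiv_at m (\<lambda>z. G z $ j $ k) y - pderiv_at k (\<lambda>z. G z $ m $ j) y)) = \<dots>" .
  have cancel: "P + Q + (S - 2 * P) / 2 = Q + S / 2" for P Q S :: real by (simp add: field_simps)
  have "(G y ** covd G (grad G f) y) $ k $ m = (\<Sum>a\<in>UNIV. \<Sum>b\<in>UNIV. ?J a k * ?J b m * ?ddh b a)
      + ((\<Sum>j\<in>UNIV. ?X j * D j m k) - (\<Sum>j\<in>UNIV. ?X j * D m j k) - (\<Sum>j\<in>UNIV. ?X j * D k m j)) / 2"
    unfolding src.hessian_eq[OF f y] ddf sumX Xal by (rule cancel)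
  also have "\<dots> = (\<Sum>a\<in>UNIV. \<Sum>b\<in>UNIV. ?J a k * ?J b m * (?ddh b a
      + (\<Sum>c\<in>UNIV. ?Y c * (?dM c b a - ?dM b c a - ?dM a b c)) / 2))"
    unfolding XD1 XD2 XD3
    by (simp add: distrib_left sum.distrib right_diff_distrib sum_subtractf diff_divide_distrib sum_divide_distrib[symmetric])
  finally show ?thesis unfolding tgt.hessian_eq[OF h w] .
qed

text \<open>Cancelling J^T M in \<open>hessian_comp\<close> shows that the two covariant derivatives
  are conjugate by the Jacobian J, so their traces agree.\<close>

lemma laplace_comp:
  assumes y: "y \<in> U" shows "laplace_coord G f y = laplace_coord M h (\<phi> y)"
proof -
  let ?J = "jac_matrix y" and ?N = "covd G (grad G f) y" and ?N' = "covd M (grad M h) (\<phi> y)"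
  have "G y ** ?N = transpose ?J ** (M (\<phi> y) ** ?N') ** ?J"
    by (simp add: vec_eq_iff hessian_comp[OF y] congruence_nth mult_ac)
  then have "(transpose ?J ** M (\<phi> y)) ** (?J ** ?N) = (transpose ?J ** M (\<phi> y)) ** (?N' ** ?J)"
    by (simp add: metric_matrix[OF y] matrix_mul_assoc)
  moreover have "invertible (transpose ?J ** M (\<phi> y))"
    using jac_invertible[OF y] tgt.G_inv[OF phi_in[OF y]] by (simp add: invertible_det_nz det_transpose det_mul)
  ultimately have JN: "?J ** ?N = ?N' ** ?J"
    by (metis invertible_left_cancel)
  have "?N = matrix_inv ?J ** ?J ** ?N"
    by (simp add: matrix_inv_left[OF jac_invertible[OF y]])
  also have "\<dots> = matrix_inv ?J ** (?N' ** ?J)"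
    by (simp only: JN matrix_mul_assoc[symmetric])
  finally have "trace ?N = trace (matrix_inv ?J ** (?N' ** ?J))" by (rule arg_cong)
  also have "\<dots> = trace (?N' ** ?J ** matrix_inv ?J)"
    by (rule trace_mul_sym)
  also have "\<dots> = trace ?N'"
    by (simp add: matrix_mul_assoc[symmetric] matrix_inv_right[OF jac_invertible[OF y]])
  finally show ?thesis by (simp add: laplace_coord_def divergence_eq_trace)
qed

end
end

subsection \<open>Evolution of the Harnack quantity in a chart\<close>

locale spacetime = local_metric V G for V :: "(real^'n::finite) set" and G +
  fixes T :: real
begin

definition dom :: "((real^'n) \<times> real) set" where
  "dom = V \<times> {0<..<T}"

lemma open_dom: "open dom"
  unfolding dom_def by (intro open_Times open_V) auto

lemma mem_dom: "(y, t) \<in> dom \<longleftrightarrow> y \<in> V \<and> t \<in> {0<..<T}"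
  by (simp add: dom_def)

abbreviation slice :: "(((real^'n) \<times> real) \<Rightarrow> real) \<Rightarrow> real \<Rightarrow> real^'n \<Rightarrow> real" where
  "slice f t \<equiv> \<lambda>z. f (z, t)"

abbreviation dt :: "(((real^'n) \<times> real) \<Rightarrow> real) \<Rightarrow> ((real^'n) \<times> real) \<Rightarrow> real" where
  "dt \<equiv> ddir (0, 1)"

abbreviation ds :: "'n \<Rightarrow> (((real^'n) \<times> real) \<Rightarrow> real) \<Rightarrow> ((real^'n) \<times> real) \<Rightarrow> real" where
  "ds i \<equiv> ddir (axis i 1, 0)"

section \<open>Smoothness in space-time and commutation of time with space derivatives\<close>

lemma bounded_linear_slice: "bounded_linear (\<lambda>y::real^'n. (y, 0::real))"
  by (intro bounded_linear_Pair bounded_linear_ident bounded_linear_zero)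

lemma csmooth_slice:
  assumes "csmooth dom f" "t \<in> {0<..<T}"
  shows "csmooth V (slice f t)"
  using csmooth_affine(1)[OF assms(1) bounded_linear_slice open_V, of "(0, t)"] assms(2)
  by (simp add: mem_dom)

lemma pderiv_slice:
  assumes "csmooth dom f" "(y, t) \<in> dom"
  shows "pderiv_at i (slice f t) y = ds i f (y, t)"
  using csmooth_affine(2)[OF assms(1) bounded_linear_slice open_V, of "(0, t)" y "axis i 1"] assms(2)
  by (simp add: mem_dom pderiv_at_eq)

lemma csmooth_space:
  assumes "csmooth V h"
  shows "csmooth dom (\<lambda>q. h (fst q))"
  using csmooth_affine(1)[OF assms bounded_linear_fst open_dom, of 0] by (auto simp: dom_def)

lemma dt_space:
  fixes h :: "real^'n \<Rightarrow> real"
  assumes "csmooth V h" "q \<in> dom"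
  shows "dt (\<lambda>q. h (fst q)) q = 0"
proof -
  have "dt (\<lambda>q. h (fst q)) q = ddir 0 h (fst q)"
    using csmooth_affine(2)[OF assms(1) bounded_linear_fst open_dom, of 0 q "(0, 1)"] assms(2)
    by (auto simp: dom_def)
  also have "\<dots> = 0"
    using ddir_expand[OF csmooth_differentiable[OF assms(1)], of "fst q" 0] assms(2) by (auto simp: dom_def)
  finally show ?thesis .
qed

lemma csmooth_ds: "csmooth dom f \<Longrightarrow> csmooth dom (ds i f)"
  by (rule csmooth_ddir)

lemma csmooth_dt: "csmooth dom f \<Longrightarrow> csmooth dom (dt f)"
  by (rule csmooth_ddir)

definition sgrad :: "(((real^'n) \<times> real) \<Rightarrow> real) \<Rightarrow> 'n \<Rightarrow> ((real^'n) \<times> real) \<Rightarrow> real" where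
  "sgrad f i q = grad G (slice f (snd q)) (fst q) $ i"

definition slap :: "(((real^'n) \<times> real) \<Rightarrow> real) \<Rightarrow> ((real^'n) \<times> real) \<Rightarrow> real" where
  "slap f q = laplace_coord G (slice f (snd q)) (fst q)"

definition sgrad_norm :: "(((real^'n) \<times> real) \<Rightarrow> real) \<Rightarrow> ((real^'n) \<times> real) \<Rightarrow> real" where
  "sgrad_norm f q = metric_inner G (fst q) (grad G (slice f (snd q)) (fst q)) (grad G (slice f (snd q)) (fst q))"

text \<open>Expresses the gradient by partial derivatives on space-time with coefficients that
  depend on the space variable alone; joint smoothness and commutation with \<open>dt\<close> are
  read off from this form.\<close>

lemma sgrad_eq:
  "csmooth dom f \<Longrightarrow> q \<in> dom \<Longrightarrow> sgrad f i q = (\<Sum>j\<in>UNIV. matrix_inv (G (fst q)) $ i $ j * ds j f q)"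
  using pderiv_slice[of f "fst q" "snd q"] by (simp add: sgrad_def grad_nth)

lemma csmooth_sgrad:
  assumes f: "csmooth dom f" shows "csmooth dom (sgrad f i)"
proof -
  have "csmooth dom (\<lambda>q. \<Sum>j\<in>UNIV. matrix_inv (G (fst q)) $ i $ j * ds j f q)"
    by (intro csmooth_sum csmooth_mult csmooth_ds f open_dom csmooth_space[OF csmooth_H])
  then show ?thesis by (rule csmooth_cong) (simp add: sgrad_eq[OF f])
qed

lemma dt_sgrad:
  assumes f: "csmooth dom f" and q: "q \<in> dom"
  shows "dt (sgrad f i) q = sgrad (dt f) i q"
proof -
  note H = csmooth_space[OF csmooth_H]
  have "dt (sgrad f i) q = dt (\<lambda>q. \<Sum>j\<in>UNIV. matrix_inv (G (fst q)) $ i $ j * ds j f q) q"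
    by (rule ddir_cong_open[OF open_dom q]) (rule sgrad_eq[OF f])
  also have "\<dots> = (\<Sum>j\<in>UNIV. matrix_inv (G (fst q)) $ i $ j * ds j (dt f) q)"
    by (simp add: ddir_sum[OF open_dom q csmooth_mult[OF H csmooth_ds[OF f]]]
        ddir_mult_csmooth[OF H csmooth_ds[OF f] q] dt_space[OF csmooth_H q] ddir_commute[OF f q, of "(0, 1)"])
  finally show ?thesis by (simp add: sgrad_eq[OF csmooth_dt[OF f] q])
qed

lemma slap_eq:
  assumes f: "csmooth dom f" and q: "q \<in> dom"
  shows "slap f q = (\<Sum>i\<in>UNIV. ds i (sgrad f i) q + (\<Sum>j\<in>UNIV. christoffel G i i j (fst q) * sgrad f j q))"
  using pderiv_slice[OF csmooth_sgrad[OF f], of "fst q" "snd q"] q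
  by (simp add: slap_def laplace_coord_def divergence_def sgrad_def)

lemma csmooth_slap:
  assumes f: "csmooth dom f" shows "csmooth dom (slap f)"
proof -
  have "csmooth dom (\<lambda>q. \<Sum>i\<in>UNIV. ds i (sgrad f i) q
      + (\<Sum>j\<in>UNIV. christoffel G i i j (fst q) * sgrad f j q))"
    by (intro csmooth_sum csmooth_add csmooth_mult csmooth_ds csmooth_sgrad f open_dom
        csmooth_space[OF csmooth_christoffel])
  then show ?thesis by (rule csmooth_cong) (simp add: slap_eq[OF f])
qed

text \<open>The metric is independent of time, so \<open>dt\<close> passes the coefficients, and it
  commutes with the space derivatives by \<open>ddir_commute\<close>.\<close>

lemma dt_slap:
  assumes f: "csmooth dom f" and q: "q \<in> dom"
  shows "dt (slap f) q = slap (dt f) q"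
proof -
  note C = csmooth_space[OF csmooth_christoffel] and X = csmooth_sgrad[OF f]
  have comm: "dt (ds i (sgrad f i)) q = ds i (sgrad (dt f) i) q" for i
    unfolding ddir_commute[OF X q, of "(0, 1)"]
    by (rule ddir_cong_open[OF open_dom q]) (rule dt_sgrad[OF f])
  have "dt (slap f) q = dt (\<lambda>q. \<Sum>i\<in>UNIV. ds i (sgrad f i) q
      + (\<Sum>j\<in>UNIV. christoffel G i i j (fst q) * sgrad f j q)) q"
    by (rule ddir_cong_open[OF open_dom q]) (rule slap_eq[OF f])
  also have "\<dots> = (\<Sum>i\<in>UNIV. dt (\<lambda>q. ds i (sgrad f i) q
      + (\<Sum>j\<in>UNIV. christoffel G i i j (fst q) * sgrad f j q)) q)"
    by (intro ddir_sum[OF open_dom q] csmooth_add csmooth_ds csmooth_sum csmooth_mult C X open_dom)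
  also have "\<dots> = (\<Sum>i\<in>UNIV. dt (ds i (sgrad f i)) q
      + dt (\<lambda>q. \<Sum>j\<in>UNIV. christoffel G i i j (fst q) * sgrad f j q) q)"
    by (intro sum.cong refl ddir_add csmooth_differentiable[OF _ q] csmooth_ds csmooth_sum csmooth_mult C X open_dom)
  also have "\<dots> = (\<Sum>i\<in>UNIV. ds i (sgrad (dt f) i) q
      + (\<Sum>j\<in>UNIV. christoffel G i i j (fst q) * sgrad (dt f) j q))"
    by (simp add: comm ddir_sum[OF open_dom q csmooth_mult[OF C X]] ddir_mult_csmooth[OF C X q]
        dt_space[OF csmooth_christoffel q] dt_sgrad[OF f q])
  finally show ?thesis by (simp add: slap_eq[OF csmooth_dt[OF f] q])
qed

lemma sgrad_norm_eq:
  assumes f: "csmooth dom f" and q: "q \<in> dom"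
  shows "sgrad_norm f q = (\<Sum>i\<in>UNIV. sgrad f i q * ds i f q)"
  using metric_inner_grad[of "fst q"] pderiv_slice[OF f, of "fst q" "snd q"] q
  by (auto simp: sgrad_norm_def sgrad_def dom_def)

lemma csmooth_sgrad_norm:
  assumes f: "csmooth dom f" shows "csmooth dom (sgrad_norm f)"
proof -
  have "csmooth dom (\<lambda>q. \<Sum>i\<in>UNIV. sgrad f i q * ds i f q)"
    by (intro csmooth_sum csmooth_mult csmooth_ds csmooth_sgrad f open_dom)
  then show ?thesis by (rule csmooth_cong) (simp add: sgrad_norm_eq[OF f])
qed

text \<open>The product rule gives two sums, equal because the inverse metric is symmetric.\<close>

lemma dt_sgrad_norm:
  assumes f: "csmooth dom f" and q: "q \<in> dom"
  shows "dt (sgrad_norm f) q = 2 * (\<Sum>i\<in>UNIV. sgrad f i q * ds i (dt f) q)"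
proof -
  let ?H = "matrix_inv (G (fst q))"
  have H: "?H $ i $ j = ?H $ j $ i" for i j
    by (rule symmetric_nth[OF H_sym]) (use q in \<open>auto simp: dom_def\<close>)
  have "dt (sgrad_norm f) q = dt (\<lambda>q. \<Sum>i\<in>UNIV. sgrad f i q * ds i f q) q"
    by (rule ddir_cong_open[OF open_dom q]) (rule sgrad_norm_eq[OF f])
  also have "\<dots> = (\<Sum>i\<in>UNIV. sgrad (dt f) i q * ds i f q) + (\<Sum>i\<in>UNIV. sgrad f i q * ds i (dt f) q)"
    by (simp add: ddir_sum[OF open_dom q csmooth_mult[OF csmooth_sgrad csmooth_ds, OF f f]]
        ddir_mult_csmooth[OF csmooth_sgrad csmooth_ds, OF f f q] dt_sgrad[OF f q]
        ddir_commute[OF f q, of "(0, 1)"] sum.distrib)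
  also have "(\<Sum>i\<in>UNIV. sgrad (dt f) i q * ds i f q) = (\<Sum>i\<in>UNIV. sgrad f i q * ds i (dt f) q)"
    unfolding sgrad_eq[OF f q] sgrad_eq[OF csmooth_dt[OF f] q] sum_distrib_right
    by (rule trans[OF sum.swap]) (simp add: H[of _ i for i] mult_ac)
  finally show ?thesis by simp
qed

text \<open>By the equation, the Harnack quantity divided by \<open>t\<close> is \<open>harnack_density\<close>, in which neither
  \<open>\<lambda>\<close> nor a time derivative occurs.\<close>

definition harnack_density :: "real \<Rightarrow> (((real^'n) \<times> real) \<Rightarrow> real) \<Rightarrow> ((real^'n) \<times> real) \<Rightarrow> real" where
  "harnack_density a w q = - a * slap w q + (1 - a) * sgrad_norm w q"

lemma csmooth_harnack_density: "csmooth dom w \<Longrightarrow> csmooth dom (harnack_density a w)"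
  unfolding harnack_density_def[abs_def]
  by (intro csmooth_add csmooth_cmult csmooth_slap csmooth_sgrad_norm)

lemma dt_harnack_density:
  assumes w: "csmooth dom w" and q: "q \<in> dom"
  shows "dt (harnack_density a w) q =
    - a * slap (dt w) q + (1 - a) * (2 * (\<Sum>i\<in>UNIV. sgrad w i q * ds i (dt w) q))"
proof -
  have "dt (harnack_density a w) q = dt (\<lambda>q. - a * slap w q) q + dt (\<lambda>q. (1 - a) * sgrad_norm w q) q"
    unfolding harnack_density_def[abs_def]
    by (intro ddir_add csmooth_differentiable[OF _ q] csmooth_cmult csmooth_slap csmooth_sgrad_norm w)
  also have "\<dots> = - a * dt (slap w) q + (1 - a) * dt (sgrad_norm w) q"
    using ddir_mult_csmooth[OF csmooth_const[OF open_dom] csmooth_slap[OF w] q, of "(0, 1)" "- a"]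
      ddir_mult_csmooth[OF csmooth_const[OF open_dom] csmooth_sgrad_norm[OF w] q, of "(0, 1)" "1 - a"] by simp
  finally show ?thesis by (simp only: dt_slap[OF w q] dt_sgrad_norm[OF w q])
qed

text \<open>An inequality replaces the full evolution equation: at a spatial maximum the gradient of
  the density vanishes and its Laplacian is nonpositive. The heat equation is used on one time
  slice, where \<lambda> has the constant value \<open>l\<close>.\<close>

lemma harnack_density_at_spatial_max:
  assumes w: "csmooth dom w" and q: "(y, t) \<in> dom"
    and heat: "\<And>z. z \<in> V \<Longrightarrow> dt w (z, t) = slap w (z, t) + sgrad_norm w (z, t) + l - exp ((p - 1) * w (z, t))"
    and max: "\<And>z. z \<in> V \<Longrightarrow> harnack_density a w (z, t) \<le> harnack_density a w (y, t)"
  defines "v \<equiv> exp ((p - 1) * w (y, t))" and "X \<equiv> grad G (slice w t) y"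
  shows "dt (harnack_density a w) (y, t) \<le> - 2 * (slap w (y, t))\<^sup>2 / real CARD('n) - 2 * ricci G y X X
    - (p - 1) * v * harnack_density a w (y, t)
    + (a * (p - 1)\<^sup>2 + (a - 1) * (p - 1)) * (v * sgrad_norm w (y, t))"
proof -
  have y: "y \<in> V" and t: "t \<in> {0<..<T}" using q by (auto simp: dom_def)
  define f where "f = slice w t"
  define L where "L = laplace_coord G f"
  define N where "N z = metric_inner G z (grad G f z) (grad G f z)" for z
  define E where "E z = exp ((p - 1) * f z)" for z
  define h where "h = slice (dt w) t"
  define Q where "Q = slice (harnack_density a w) t"
  have f: "csmooth V f" unfolding f_def by (rule csmooth_slice[OF w t])
  have L: "csmooth V L" unfolding L_def by (rule csmooth_laplace[OF f])
  have N: "csmooth V N" unfolding N_def[abs_def] by (rule csmooth_grad_norm[OF f])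
  have E: "csmooth V E" unfolding E_def[abs_def] by (intro csmooth_exp csmooth_cmult f)
  have l: "csmooth V (\<lambda>_. l)" by (rule csmooth_const[OF open_V])
  have hE: "h z = L z + N z + l + (-1) * E z" if "z \<in> V" for z
    using heat[OF that] by (simp add: h_def L_def N_def E_def f_def slap_def sgrad_norm_def)
  have QE: "Q = (\<lambda>z. - a * L z + (1 - a) * N z)"
    by (simp add: Q_def L_def N_def f_def harnack_density_def slap_def sgrad_norm_def)
  have Q: "csmooth V Q" unfolding QE by (intro csmooth_add csmooth_cmult L N)
  \<comment> \<open>The derivative in the direction of the gradient, \<nabla>w \<cdot> \<nabla>, at
    the point \<open>y\<close>.\<close>
  define D where "D k = (\<Sum>i\<in>UNIV. X $ i * pderiv_at i k y)" for k
  have Xf: "X = grad G f y" by (simp add: X_def f_def)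
  have DX: "D f = N y" by (simp add: D_def N_def metric_inner_grad[OF y] Xf)
  have D_add: "D (\<lambda>z. k z + k' z) = D k + D k'" if "csmooth V k" "csmooth V k'" for k k'
    by (simp add: D_def pderiv_add[OF that y] distrib_left sum.distrib)
  have D_cmult: "D (\<lambda>z. c * k z) = c * D k" if "csmooth V k" for k c
    by (simp add: D_def pderiv_cmult[OF that y] sum_distrib_left mult_ac)
  have hl: "laplace_coord G h y = laplace_coord G L y + laplace_coord G N y - laplace_coord G E y"
    by (simp only: laplace_cong[OF y hE] laplace_add[OF csmooth_add[OF csmooth_add[OF L N] l] csmooth_cmult[OF E] y]
        laplace_add[OF csmooth_add[OF L N] l y] laplace_add[OF L N y] laplace_cmult[OF E y] laplace_const)
  have Dh: "D h = D L + D N - D E"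
  proof -
    have "D h = D (\<lambda>z. L z + N z + l + (-1) * E z)"
      unfolding D_def by (intro sum.cong refl arg_cong2[where f="(*)"] pderiv_cong[OF open_V y] hE)
    moreover have "D (\<lambda>_. l) = 0" by (simp add: D_def)
    ultimately show ?thesis
      by (simp only: D_add[OF csmooth_add[OF csmooth_add[OF L N] l] csmooth_cmult[OF E]]
        D_add[OF csmooth_add[OF L N] l] D_add[OF L N] D_cmult[OF E])
  qed
  have Qmax: "Q z \<le> Q y" if "z \<in> V" for z using max[OF that] by (simp add: Q_def)
  have DQ: "- a * D L + (1 - a) * D N = 0"
  proof -
    have "D Q = 0" using laplace_max(1)[OF Q y Qmax] by (simp add: D_def)
    then show ?thesis unfolding QE by (simp only: D_add[OF csmooth_cmult[OF L] csmooth_cmult[OF N]] D_cmult[OF L] D_cmult[OF N])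
  qed
  have LQ: "- a * laplace_coord G L y + (1 - a) * laplace_coord G N y \<le> 0"
    using laplace_max(2)[OF Q y Qmax] unfolding QE
    by (simp only: laplace_add[OF csmooth_cmult[OF L] csmooth_cmult[OF N] y] laplace_cmult[OF L y] laplace_cmult[OF N y])
  have v: "v = E y" by (simp add: v_def E_def f_def)
  have LE: "laplace_coord G E y = (p - 1) * v * (L y + (p - 1) * N y)"
    using laplace_exp[OF f y, of "p - 1"] by (simp add: E_def[abs_def] v L_def N_def)
  have DE: "D E = (p - 1) * v * N y"
  proof -
    have "pderiv_at i E y = (p - 1) * v * pderiv_at i f y" for i
      using ddir_chain(1)[where f="\<lambda>z. (p - 1) * f z" and h=exp,
          OF csmooth_differentiable[OF csmooth_cmult[OF f] y] DERIV_exp]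
        pderiv_cmult[OF f y, of i "p - 1"] by (simp add: pderiv_at_eq E_def[abs_def] v)
    then show ?thesis by (simp add: DX[symmetric] D_def sum_distrib_left mult_ac)
  qed
  have LN: "laplace_coord G N y = 2 * D L + 2 * ricci G y X X
      + 2 * trace (covd G (grad G f) y ** covd G (grad G f) y)"
    using bochner[OF f y] by (simp add: N_def[abs_def] D_def L_def Xf)
  have tr: "(L y)\<^sup>2 / real CARD('n) \<le> trace (covd G (grad G f) y ** covd G (grad G f) y)"
    using trace_hessian_square_ge[OF f y] by (simp add: L_def)
  have "dt (harnack_density a w) (y, t) = - a * laplace_coord G h y + (1 - a) * (2 * D h)"
    using dt_harnack_density[OF w q, of a] pderiv_slice[OF csmooth_dt[OF w] q]
    by (simp add: slap_def h_def D_def Xf f_def sgrad_def)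
  \<comment> \<open>The first bracket is the Laplacian of \<open>Q\<close>, the second the
    derivative \<open>D Q\<close>. The remaining \<open>D L\<close> cancels against the one that the
    Bochner formula produces from the Laplacian of \<open>N\<close>.\<close>
  also have "\<dots> = (- a * laplace_coord G L y + (1 - a) * laplace_coord G N y) - laplace_coord G N y
      + a * laplace_coord G E y + 2 * (- a * D L + (1 - a) * D N) + 2 * D L + 2 * (a - 1) * D E"
    unfolding hl Dh by (simp add: algebra_simps)
  also have "\<dots> \<le> - 2 * (L y)\<^sup>2 / real CARD('n) - 2 * ricci G y X X
      + a * laplace_coord G E y + 2 * (a - 1) * D E"
    using LQ DQ LN tr by simp
  finally have "dt (harnack_density a w) (y, t) \<le> - 2 * (L y)\<^sup>2 / real CARD('n) - 2 * ricci G y X X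
      + a * laplace_coord G E y + 2 * (a - 1) * D E" .
  \<comment> \<open>Eliminating \<open>L y\<close> in favour of \<open>Q y\<close> is the origin of
    the coefficient of \<open>v * N y\<close>.\<close>
  moreover have "a * laplace_coord G E y + 2 * (a - 1) * D E
      = - (p - 1) * v * Q y + (a * (p - 1)\<^sup>2 + (a - 1) * (p - 1)) * (v * N y)"
    unfolding LE DE QE by (simp add: algebra_simps power2_eq_square)
  moreover have S: "slap w (y, t) = L y" "sgrad_norm w (y, t) = N y" "harnack_density a w (y, t) = Q y"
    by (simp_all add: Q_def L_def N_def f_def slap_def sgrad_norm_def)
  ultimately show ?thesis unfolding S by linarith
qed

end

subsection \<open>The maximum principle on the manifold\<close>

context riemannian_manifold begin

abbreviation range_of :: "('m, 'n) chart \<Rightarrow> (real^'n) set" where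
  "range_of c \<equiv> snd c ` fst c"

lemma chart_inv_left: "c \<in> A \<Longrightarrow> x \<in> fst c \<Longrightarrow> chart_inv c (snd c x) = x"
  using chart_homeomorphism homeomorphism_apply1 by blast

lemma local_metric_chart: "c \<in> A \<Longrightarrow> local_metric (range_of c) (g c)"
  using metric_symmetric metric_positive
  by (unfold_locales) (auto intro: open_range smooth_on_imp_csmooth[OF metric_smooth])

lemma open_overlap:
  assumes c: "c \<in> A" and d: "d \<in> A"
  shows "open (snd c ` (fst c \<inter> fst d))"
proof -
  have "openin (top_of_set (fst c)) (fst c \<inter> fst d)"
    using open_domain[OF d] by (auto simp: openin_open)
  then have "openin (top_of_set (range_of c)) (snd c ` (fst c \<inter> fst d))"
    using homeomorphism_imp_open_map[OF chart_homeomorphism[OF c]] by blast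
  then show ?thesis using open_range[OF c] openin_open_trans by blast
qed

lemma chart_change_overlap:
  assumes c: "c \<in> A" and d: "d \<in> A"
  shows "chart_change (snd c ` (fst c \<inter> fst d)) (g c) (range_of d) (g d) (snd d \<circ> chart_inv c)"
proof -
  interpret C: local_metric "range_of c" "g c" by (rule local_metric_chart[OF c])
  interpret D: local_metric "range_of d" "g d" by (rule local_metric_chart[OF d])
  show ?thesis
  proof
    show "csmooth (snd c ` (fst c \<inter> fst d)) (g c)"
      by (rule csmooth_subset[OF C.G_smooth _ open_overlap[OF c d]]) auto
    show "csmooth (snd c ` (fst c \<inter> fst d)) (snd d \<circ> chart_inv c)"
      by (rule smooth_on_imp_csmooth[OF smooth_transition[OF c d] _ open_overlap[OF c d]]) auto
    fix y assume "y \<in> snd c ` (fst c \<inter> fst d)"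
    then obtain x where x: "x \<in> fst c \<inter> fst d" "y = snd c x" by blast
    show "(snd d \<circ> chart_inv c) y \<in> range_of d" using x chart_inv_left[OF c] by auto
    fix v w
    show "metric_inner (g c) y v w = metric_inner (g d) ((snd d \<circ> chart_inv c) y)
        (frechet_derivative (snd d \<circ> chart_inv c) (at y) v)
        (frechet_derivative (snd d \<circ> chart_inv c) (at y) w)"
      using metric_transform[OF c d x(1), of v w] x chart_inv_left[OF c] by simp
  qed (use C.G_sym C.G_pos open_overlap[OF c d] in auto)
qed

lemma chart_at: "chart_at A x \<in> A" "x \<in> fst (chart_at A x)"
proof -
  have "\<exists>c. c \<in> A \<and> x \<in> fst c" using atlas_covers by blast
  from someI_ex[OF this] show "chart_at A x \<in> A" "x \<in> fst (chart_at A x)"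
    by (auto simp: chart_at_def)
qed

context
  fixes F :: "'m \<Rightarrow> real"
  assumes F: "\<And>c. c \<in> A \<Longrightarrow> csmooth (range_of c) (F \<circ> chart_inv c)"
begin

text \<open>The chart chosen by \<open>chart_at\<close> may jump from point to point, so derivatives
  of these scalars cannot be taken in the definitions as they stand. Invariance permits one fixed
  chart throughout its domain.\<close>

lemma invariants_in_chart:
  assumes c: "c \<in> A" and x: "x \<in> fst c"
  shows laplace_beltrami_in_chart: "laplace_beltrami A g F x = laplace_coord (g c) (F \<circ> chart_inv c) (snd c x)"
    and grad_norm_sq_in_chart: "grad_norm_sq A g F x = metric_inner (g c) (snd c x)
      (grad (g c) (F \<circ> chart_inv c) (snd c x)) (grad (g c) (F \<circ> chart_inv c) (snd c x))"
proof -
  define d where "d = chart_at A x"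
  have d: "d \<in> A" "x \<in> fst d" by (simp_all add: d_def chart_at)
  interpret chart_change "snd c ` (fst c \<inter> fst d)" "g c" "range_of d" "g d" "snd d \<circ> chart_inv c"
    by (rule chart_change_overlap[OF c d(1)])
  have f: "csmooth (snd c ` (fst c \<inter> fst d)) (F \<circ> chart_inv c)"
    by (rule csmooth_subset[OF F[OF c]]) (auto simp: open_overlap c d)
  have fh: "(F \<circ> chart_inv c) y = (F \<circ> chart_inv d) ((snd d \<circ> chart_inv c) y)"
    if "y \<in> snd c ` (fst c \<inter> fst d)" for y
    using that chart_inv_left[OF c] chart_inv_left[OF d(1)] by auto
  have y: "snd c x \<in> snd c ` (fst c \<inter> fst d)" using x d by auto
  have to: "(snd d \<circ> chart_inv c) (snd c x) = snd d x" using chart_inv_left[OF c x] by simp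
  show "laplace_beltrami A g F x = laplace_coord (g c) (F \<circ> chart_inv c) (snd c x)"
    using laplace_comp[OF f F[OF d(1)] fh y] unfolding to
    by (simp add: laplace_beltrami_def Let_def d_def comp_def)
  show "grad_norm_sq A g F x = metric_inner (g c) (snd c x)
      (grad (g c) (F \<circ> chart_inv c) (snd c x)) (grad (g c) (F \<circ> chart_inv c) (snd c x))"
    using grad_norm_comp[OF f F[OF d(1)] fh y] unfolding to
    by (simp add: grad_norm_sq_def Let_def d_def comp_def)
qed

end

lemma spacetime_chart: "c \<in> A \<Longrightarrow> spacetime (range_of c) (g c)"
  unfolding spacetime_def by (rule local_metric_chart)

end

section \<open>The solution and its logarithm in charts\<close>

locale heat_flow = riemannian_manifold A g
  for A :: "('m::{t2_space,second_countable_topology}, 'n::finite) chart set"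
    and g :: "('m, 'n) chart \<Rightarrow> real^'n \<Rightarrow> real^'n^'n" +
  fixes T p lam u
  assumes heat: "heat_solution A g T p lam u"
begin

definition log_chart :: "('m, 'n) chart \<Rightarrow> (real^'n) \<times> real \<Rightarrow> real" where
  "log_chart c q = ln (u (chart_inv c (fst q)) (snd q))"

definition chart_dom :: "('m, 'n) chart \<Rightarrow> ((real^'n) \<times> real) set" where
  "chart_dom c = range_of c \<times> {0<..<T}"

lemma u_pos: "t \<in> {0<..<T} \<Longrightarrow> u x t > 0"
  using heat by (auto simp: heat_solution_def)

lemma csmooth_u: "c \<in> A \<Longrightarrow> csmooth (chart_dom c) (\<lambda>q. u (chart_inv c (fst q)) (snd q))"
  unfolding chart_dom_def
  by (rule smooth_on_imp_csmooth[of "range_of c \<times> {0..<T}"])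
     (use heat open_range in \<open>auto simp: heat_solution_def smooth_spacetime_def case_prod_unfold intro!: open_Times\<close>)

lemma csmooth_log_chart: "c \<in> A \<Longrightarrow> csmooth (chart_dom c) (log_chart c)"
  unfolding log_chart_def[abs_def] using u_pos
  by (intro csmooth_ln csmooth_u) (auto simp: chart_dom_def)

lemma u_eq_exp: "t \<in> {0<..<T} \<Longrightarrow> u (chart_inv c y) t = exp (log_chart c (y, t))"
  using u_pos by (simp add: log_chart_def)

lemma time_deriv_chart:
  assumes c: "c \<in> A" "x \<in> fst c" and t: "t \<in> {0<..<T}"
    and F: "csmooth (chart_dom c) (\<lambda>q. f (chart_inv c (fst q)) (snd q))"
  shows "time_deriv T f x t = ddir (0, 1) (\<lambda>q. f (chart_inv c (fst q)) (snd q)) (snd c x, t)"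
proof -
  let ?F = "\<lambda>q. f (chart_inv c (fst q)) (snd q)"
  have "?F differentiable (at ((snd c x, 0) + t *\<^sub>R (0, 1)))"
    using csmooth_differentiable[OF F, of "(snd c x, t)"] c t by (simp add: chart_dom_def)
  from ddir_line[OF this]
  have "(f x has_real_derivative ddir (0, 1) ?F (snd c x, t)) (at t)"
    using chart_inv_left[OF c] by simp
  then have d: "(f x has_vector_derivative ddir (0, 1) ?F (snd c x, t)) (at t)"
    by (simp add: has_real_derivative_iff_has_vector_derivative)
  have "at t within {0..<T} = at t"
    by (rule at_within_interior) (use t in \<open>auto simp: mem_interior intro!: interiorI[of "{0<..<T}"]\<close>)
  then show ?thesis using vector_derivative_at[OF d] by (simp add: time_deriv_def)
qed

lemma slice_log_chart:
  assumes "t \<in> {0<..<T}" "c \<in> A"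
  shows "csmooth (range_of c) ((\<lambda>z. ln (u z t)) \<circ> chart_inv c)"
    and "csmooth (range_of c) ((\<lambda>z. u z t) \<circ> chart_inv c)"
proof -
  interpret spacetime "range_of c" "g c" T by (rule spacetime_chart[OF assms(2)])
  have D: "dom = chart_dom c" by (simp add: dom_def chart_dom_def)
  show "csmooth (range_of c) ((\<lambda>z. ln (u z t)) \<circ> chart_inv c)"
    using csmooth_slice[OF _ assms(1), unfolded D, OF csmooth_log_chart[OF assms(2)]]
    by (simp add: log_chart_def comp_def)
  show "csmooth (range_of c) ((\<lambda>z. u z t) \<circ> chart_inv c)"
    using csmooth_slice[OF _ assms(1), unfolded D, OF csmooth_u[OF assms(2)]]
    by (simp add: comp_def)
qed

abbreviation density :: "real \<Rightarrow> ('m, 'n) chart \<Rightarrow> (real^'n) \<times> real \<Rightarrow> real" where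
  "density a c \<equiv> spacetime.harnack_density (g c) a (log_chart c)"

text \<open>The heat equation divided by u = exp w, where u_t = u w_t, \<Delta>u = u (\<Delta>w +
  |\<nabla>w|^2) and u^p = u u^(p-1).\<close>

lemma heat_log_chart:
  assumes c: "c \<in> A" and x: "x \<in> fst c" and t: "t \<in> {0<..<T}"
  shows "ddir (0, 1) (log_chart c) (snd c x, t) = spacetime.slap (g c) (log_chart c) (snd c x, t)
      + spacetime.sgrad_norm (g c) (log_chart c) (snd c x, t) + lam t
      - exp ((p - 1) * log_chart c (snd c x, t))" (is "?dw = ?L + ?N + _ - ?v")
proof -
  interpret spacetime "range_of c" "g c" T by (rule spacetime_chart[OF c])
  let ?q = "(snd c x, t)" and ?w = "log_chart c"
  let ?u = "u x t"
  have D: "dom = chart_dom c" by (simp add: dom_def chart_dom_def)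
  have q: "?q \<in> chart_dom c" using x t by (simp add: chart_dom_def)
  have u: "?u = exp (?w ?q)" using u_eq_exp[OF t, of c "snd c x"] chart_inv_left[OF c x] by simp
  have eq: "time_deriv T u x t - laplace_beltrami A g (\<lambda>z. u z t) x = lam t * ?u - ?u powr p"
    using heat t by (auto simp: heat_solution_def)
  have "time_deriv T u x t = ddir (0, 1) (\<lambda>q. exp (?w q)) ?q"
    unfolding time_deriv_chart[OF c x t csmooth_u[OF c]]
    by (rule ddir_cong_open[OF csmooth_open[OF csmooth_u[OF c]] q]) (auto simp: chart_dom_def u_eq_exp)
  also have "\<dots> = ?u * ?dw"
    using ddir_chain(1)[where h=exp, OF csmooth_differentiable[OF csmooth_log_chart[OF c] q] DERIV_exp]
    by (simp add: u)
  finally have 1: "time_deriv T u x t = ?u * ?dw" .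
  have w: "csmooth (range_of c) (\<lambda>z. ?w (z, t))"
    by (rule csmooth_slice[OF _ t]) (simp add: D csmooth_log_chart[OF c])
  have "laplace_beltrami A g (\<lambda>z. u z t) x = laplace_coord (g c) ((\<lambda>z. u z t) \<circ> chart_inv c) (snd c x)"
    by (rule laplace_beltrami_in_chart[OF slice_log_chart(2)[OF t] c x])
  \<comment> \<open>The factor 1 brings the exponential into the form of
    \<open>laplace_exp\<close>.\<close>
  also have "\<dots> = laplace_coord (g c) (\<lambda>z. exp (1 * ?w (z, t))) (snd c x)"
    by (rule laplace_cong) (use x t in \<open>simp_all add: u_eq_exp\<close>)
  also have "\<dots> = ?u * (?L + ?N)"
    unfolding laplace_exp[OF w imageI[OF x]] by (simp add: u slap_def sgrad_norm_def)
  finally have 2: "laplace_beltrami A g (\<lambda>z. u z t) x = ?u * (?L + ?N)" .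
  have "?u powr p = ?u * ?v"
    by (simp add: u powr_def exp_add[symmetric] algebra_simps)
  then have "?u * (?dw - (?L + ?N) - lam t + ?v) = 0"
    using eq unfolding 1 2 by (simp add: algebra_simps)
  then have "?dw - (?L + ?N) - lam t + ?v = 0" using u_pos[OF t, of x] by simp
  then show ?thesis by simp
qed

lemma harnack_quantity_chart:
  assumes c: "c \<in> A" and x: "x \<in> fst c" and t: "t \<in> {0<..<T}"
  shows "harnack_quantity A g T a p lam u x t = t * density a c (snd c x, t)"
proof -
  interpret spacetime "range_of c" "g c" T by (rule spacetime_chart[OF c])
  let ?q = "(snd c x, t)"
  have w: "(\<lambda>q. ln (u (chart_inv c (fst q)) (snd q))) = log_chart c" by (simp add: log_chart_def fun_eq_iff)
  have grad_norm: "grad_norm_sq A g (\<lambda>z. ln (u z t)) x = sgrad_norm (log_chart c) ?q"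
    by (rule trans[OF grad_norm_sq_in_chart[OF slice_log_chart(1)[OF t] c x]])
       (simp_all add: sgrad_norm_def log_chart_def comp_def)
  have time: "time_deriv T (\<lambda>z s. ln (u z s)) x t = ddir (0, 1) (log_chart c) ?q"
    using time_deriv_chart[OF c x t, of "\<lambda>z s. ln (u z s)"] csmooth_log_chart[OF c] by (simp add: w)
  have power: "u x t powr (p - 1) = exp ((p - 1) * log_chart c ?q)"
    using u_pos[OF t, of x] chart_inv_left[OF c x] by (simp add: powr_def log_chart_def)
  show ?thesis
    unfolding harnack_quantity_def Let_def grad_norm time power heat_log_chart[OF c x t] harnack_density_def
    by (simp add: algebra_simps)
qed

text \<open>Checked in a chart, where the quantity divided by \<open>t\<close> is the smooth
  \<open>density\<close>. Ensures that the maximum over a compact slab is attained.\<close>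

lemma continuous_harnack:
  assumes t: "t \<in> {0<..<T}"
  shows "continuous (at (x, t)) (\<lambda>(x, t). (t - e) * (harnack_quantity A g T a p lam u x t / t))"
proof -
  define c where "c = chart_at A x"
  have c: "c \<in> A" "x \<in> fst c" by (simp_all add: c_def chart_at)
  interpret spacetime "range_of c" "g c" T by (rule spacetime_chart[OF c(1)])
  have D: "dom = chart_dom c" by (simp add: dom_def chart_dom_def)
  let ?S = "fst c \<times> {0<..<T}"
  have "continuous_on (chart_dom c) (density a c)"
    using csmooth_continuous[OF csmooth_harnack_density] csmooth_log_chart[OF c(1)] D by metis
  moreover have "continuous_on ?S (\<lambda>q. (snd c (fst q), snd q))"
    using chart_homeomorphism[OF c(1)]
    by (intro continuous_intros) (auto simp: homeomorphism_def intro: continuous_on_compose2[OF _ continuous_on_fst])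
  ultimately have "continuous_on ?S (\<lambda>q. density a c (snd c (fst q), snd q))"
    by (rule continuous_on_compose2) (auto simp: chart_dom_def)
  then have "continuous_on ?S (\<lambda>q. (snd q - e) * density a c (snd c (fst q), snd q))"
    by (intro continuous_intros)
  then have "continuous_on ?S (\<lambda>(x, t). (t - e) * (harnack_quantity A g T a p lam u x t / t))"
    by (rule continuous_on_eq) (auto simp: harnack_quantity_chart[OF c(1)])
  moreover have "open ?S" using open_domain[OF c(1)] by (intro open_Times) auto
  ultimately show ?thesis using c t by (simp add: continuous_on_eq_continuous_at)
qed

end

text \<open>The reals are the data at the maximum: \<open>\<tau>\<close> is t - e, \<open>L\<close>
  is \<Delta>w, \<open>y\<close> is |\<nabla>w|^2, \<open>v\<close> is u^(p-1) and \<open>d\<close>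
  is the time derivative of Q. The hypothesis \<open>max\<close> says that (t - e) Q has nonnegative
  time derivative.\<close>

lemma harnack_algebra:
  fixes n a p K B T \<tau> v y L Q d :: real
  assumes n: "n > 0" and a: "a > 1" and p: "p > 1" and \<tau>: "0 < \<tau>" "\<tau> \<le> T" and v: "0 < v" "v \<le> B"
    and y: "y \<ge> 0" and Q: "Q = - a * L + (1 - a) * y" and max: "0 \<le> Q + \<tau> * d"
    and d: "d \<le> - 2 * L\<^sup>2 / n + 2 * \<bar>K\<bar> * y - (p - 1) * v * Q + (a * (p - 1)\<^sup>2 + (a - 1) * (p - 1)) * (v * y)"
  shows "\<tau> * Q \<le> n * a\<^sup>2 / 2
    + T\<^sup>2 * (n * a\<^sup>2 * (2 * \<bar>K\<bar> + (a * (p - 1)\<^sup>2 + (a - 1) * (p - 1)) * B)\<^sup>2 / (8 * (a - 1)\<^sup>2))"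
proof -
  define N where "N = n * a\<^sup>2 / 2"
  define c where "c = a * (p - 1)\<^sup>2 + (a - 1) * (p - 1)"
  \<comment> \<open>\<open>D\<close> bounds the coefficient of \<open>y\<close> in the estimate of
    \<open>d\<close>; \<open>E\<close> is the largest value of
    \<open>D * y - ((a - 1) * y)\<^sup>2 / N\<close>.\<close>
  define D where "D = 2 * \<bar>K\<bar> + c * B"
  define E where "E = n * a\<^sup>2 * D\<^sup>2 / (8 * (a - 1)\<^sup>2)"
  have N: "N > 0" using n a by (simp add: N_def)
  have c: "c \<ge> 0" using a p by (simp add: c_def)
  have E: "E \<ge> 0" using n by (simp add: E_def)
  have goal: "\<tau> * Q \<le> N + T\<^sup>2 * E"
  proof (cases "Q \<le> 0")
    case True
    then have "\<tau> * Q \<le> 0" using \<tau> by (simp add: mult_nonneg_nonpos)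
    then show ?thesis using N E by (smt (verit) mult_nonneg_nonneg zero_le_power2)
  next
    case False
    then have Qp: "Q > 0" by simp
    have "a * L = - (Q + (a - 1) * y)" using Q by (simp add: algebra_simps)
    then have "(a * L)\<^sup>2 = (Q + (a - 1) * y)\<^sup>2" by (simp only: power2_minus)
    also have "\<dots> = Q\<^sup>2 + ((a - 1) * y)\<^sup>2 + 2 * (Q * ((a - 1) * y))" by (simp add: power2_eq_square algebra_simps)
    also have "\<dots> \<ge> Q\<^sup>2 + ((a - 1) * y)\<^sup>2" using Qp a y by simp
    finally have "Q\<^sup>2 + ((a - 1) * y)\<^sup>2 \<le> (a * L)\<^sup>2" .
    then have "(Q\<^sup>2 + ((a - 1) * y)\<^sup>2) / N \<le> (a * L)\<^sup>2 / N" using N by (simp add: divide_right_mono)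
    also have "\<dots> = 2 * L\<^sup>2 / n" using n a by (simp add: N_def field_simps power2_eq_square)
    finally have L: "(Q\<^sup>2 + ((a - 1) * y)\<^sup>2) / N \<le> 2 * L\<^sup>2 / n" .
    have "v * y \<le> B * y" using v y by (simp add: mult_right_mono)
    then have "c * (v * y) \<le> c * (B * y)" using c by (rule mult_left_mono)
    then have Dy: "2 * \<bar>K\<bar> * y + c * (v * y) \<le> D * y" by (simp add: D_def algebra_simps)
    have E_eq: "E = N * D\<^sup>2 / (4 * (a - 1)\<^sup>2)" by (simp add: E_def N_def)
    \<comment> \<open>Completing the square in \<open>y\<close>.\<close>
    have "D * y - (b * y)\<^sup>2 / N - N * D\<^sup>2 / (4 * b\<^sup>2) = - ((b * y - N * D / (2 * b))\<^sup>2 / N)"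
      if "b > 0" for b
      using N that by (simp add: field_simps power2_eq_square)
    from this[of "a - 1"] have "D * y - ((a - 1) * y)\<^sup>2 / N - E
        = - (((a - 1) * y - N * D / (2 * (a - 1)))\<^sup>2 / N)"
      using a unfolding E_eq by simp
    also have "\<dots> \<le> 0" using N by simp
    finally have amgm: "D * y - ((a - 1) * y)\<^sup>2 / N \<le> E" by simp
    have "(p - 1) * v * Q \<ge> 0" using p v Qp by simp
    then have "d \<le> - (Q\<^sup>2 / N) + E"
      using d L Dy amgm unfolding c_def[symmetric] by (simp add: add_divide_distrib)
    then have "\<tau> * d \<le> \<tau> * (- (Q\<^sup>2 / N) + E)" using \<tau> by simp
    then have "0 \<le> Q + \<tau> * (- (Q\<^sup>2 / N) + E)" using max by linarith
    \<comment> \<open>This factor turns the condition into a quadratic inequality for F = \<tau> Q;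
      afterwards \<tau> is replaced by its bound \<open>T\<close> in the constant term.\<close>
    then have "0 \<le> (N * \<tau>) * (Q + \<tau> * (- (Q\<^sup>2 / N) + E))" using N \<tau> by simp
    also have "\<dots> = N * (\<tau> * Q) - (\<tau> * Q)\<^sup>2 + N * (\<tau>\<^sup>2 * E)" using N by (simp add: field_simps power2_eq_square)
    also have "\<dots> \<le> N * (\<tau> * Q) - (\<tau> * Q)\<^sup>2 + N * (T\<^sup>2 * E)"
      using N E \<tau> by (simp add: mult_left_mono mult_right_mono power_mono)
    finally have F: "(\<tau> * Q)\<^sup>2 \<le> N * (\<tau> * Q) + N * (T\<^sup>2 * E)" by simp
    show ?thesis
    proof (rule ccontr)
      assume "\<not> ?thesis"
      then have gt: "\<tau> * Q > N + T\<^sup>2 * E" by simp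
      have TE: "T\<^sup>2 * E \<ge> 0" using E by simp
      have "(N + T\<^sup>2 * E) * (\<tau> * Q) < (\<tau> * Q) * (\<tau> * Q)"
        using gt \<tau> Qp by (intro mult_strict_right_mono) auto
      moreover have "T\<^sup>2 * E * N \<le> T\<^sup>2 * E * (\<tau> * Q)" using gt TE by (intro mult_left_mono) auto
      ultimately show False using F by (simp add: power2_eq_square algebra_simps)
    qed
  qed
  then show ?thesis by (simp add: N_def E_def D_def c_def)
qed

text \<open>Maximality is known for earlier times only, since \<open>t\<close> may be the right end
  of the slab; hence a sign instead of a vanishing derivative.\<close>

lemma DERIV_nonneg_left_max:
  fixes k :: "real \<Rightarrow> real"
  assumes "(k has_real_derivative l) (at t)" "e < t" "\<And>s. e \<le> s \<Longrightarrow> s \<le> t \<Longrightarrow> k s \<le> k t"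
  shows "l \<ge> 0"
proof (rule ccontr)
  assume "\<not> ?thesis"
  then obtain d where d: "d > 0" "\<And>h. 0 < h \<Longrightarrow> h < d \<Longrightarrow> k t < k (t - h)"
    using DERIV_neg_dec_left[OF assms(1)] by auto
  define h where "h = min (d / 2) (t - e)"
  have "0 < h" "h < d" "h \<le> t - e" using d(1) assms(2) by (auto simp: h_def)
  then show False using d(2)[of h] assms(3)[of "t - h"] by simp
qed

section \<open>The bound on a compact manifold\<close>

locale compact_heat_flow = heat_flow A g T p lam u + closed_riemannian_manifold A g
  for A :: "('m::{t2_space,second_countable_topology}, 'n::finite) chart set"
    and g :: "('m, 'n) chart \<Rightarrow> real^'n \<Rightarrow> real^'n^'n" and T p lam u +
  fixes a B K :: real
  assumes ricci: "ricci_bounded_below A g (- K)" and p: "p > 1" and a: "a > 1"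
    and bound: "t \<in> {0..<T} \<Longrightarrow> u x t powr (p - 1) \<le> B"
begin

definition harnack_bound :: real where
  "harnack_bound = real CARD('n) * a\<^sup>2 / 2 + T\<^sup>2 * (real CARD('n) * a\<^sup>2 *
     (2 * \<bar>K\<bar> + (a * (p - 1)\<^sup>2 + (a - 1) * (p - 1)) * B)\<^sup>2 / (8 * (a - 1)\<^sup>2))"

lemma harnack_bound_nonneg: "harnack_bound \<ge> 0"
  unfolding harnack_bound_def by simp

text \<open>The factor \<open>t - e\<close> in place of \<open>t\<close> keeps the argument away from the initial time.\<close>

lemma harnack_at_max:
  assumes e: "e > 0" and t: "e < t0" "t0 < T"
    and max: "\<And>x t. t \<in> {e..t0} \<Longrightarrow> (t - e) * (harnack_quantity A g T a p lam u x t / t)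
      \<le> (t0 - e) * (harnack_quantity A g T a p lam u x0 t0 / t0)"
  shows "(t0 - e) * (harnack_quantity A g T a p lam u x0 t0 / t0) \<le> harnack_bound"
proof -
  define c where "c = chart_at A x0"
  have c: "c \<in> A" "x0 \<in> fst c" by (simp_all add: c_def chart_at)
  interpret spacetime "range_of c" "g c" T by (rule spacetime_chart[OF c(1)])
  define y where "y = snd c x0"
  let ?w = "log_chart c" and ?q = "(y, t0)"
  have t0: "t0 \<in> {0<..<T}" using e t by simp
  have D: "dom = chart_dom c" by (simp add: dom_def chart_dom_def)
  have w: "csmooth dom ?w" using csmooth_log_chart[OF c(1)] D by simp
  have y: "y \<in> range_of c" using c by (simp add: y_def)
  have q: "?q \<in> dom" using y t0 by (simp add: mem_dom)
  have H: "harnack_quantity A g T a p lam u (chart_inv c z) s / s = density a c (z, s)"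
    if "z \<in> range_of c" "s \<in> {0<..<T}" for z s
    using that harnack_quantity_chart[OF c(1), of "chart_inv c z" s a] chart_inv_left[OF c(1)] by auto
  have x0: "chart_inv c y = x0" using chart_inv_left[OF c] by (simp add: y_def)
  have Q0: "harnack_quantity A g T a p lam u x0 t0 / t0 = density a c ?q"
    using H[OF y t0] by (simp add: x0)
  have M: "(s - e) * density a c (z, s) \<le> (t0 - e) * density a c ?q"
    if "z \<in> range_of c" "s \<in> {e..t0}" for z s
  proof -
    have s: "s \<in> {0<..<T}" using that e t by simp
    from max[OF that(2), of "chart_inv c z"] show ?thesis unfolding Q0 H[OF that(1) s] .
  qed
  \<comment> \<open>On the slice at \<open>t0\<close> the positive weight \<open>t0 - e\<close> is
    constant and cancels.\<close>
  have spatial: "density a c (z, t0) \<le> density a c ?q" if "z \<in> range_of c" for z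
    using M[OF that, of t0] t by simp
  have heat_z: "dt ?w (z, t0) = slap ?w (z, t0) + sgrad_norm ?w (z, t0) + lam t0 - exp ((p - 1) * ?w (z, t0))"
    if "z \<in> range_of c" for z
    using that heat_log_chart[OF c(1) _ t0] by auto
  let ?X = "grad (g c) (slice ?w t0) y" and ?v = "exp ((p - 1) * ?w ?q)"
  have evol: "dt (density a c) ?q \<le> - 2 * (slap ?w ?q)\<^sup>2 / real CARD('n) - 2 * ricci (g c) y ?X ?X
    - (p - 1) * ?v * density a c ?q
    + (a * (p - 1)\<^sup>2 + (a - 1) * (p - 1)) * (?v * sgrad_norm ?w ?q)"
    by (rule harnack_density_at_spatial_max[OF w q heat_z spatial])
  have y0: "sgrad_norm ?w ?q \<ge> 0"
    using G_pos[OF y, of ?X] by (cases "?X = 0") (auto simp: sgrad_norm_def metric_inner_def less_imp_le)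
  have "ricci (g c) y ?X ?X \<ge> - K * sgrad_norm ?w ?q"
    using ricci c by (auto simp: ricci_bounded_below_def y_def sgrad_norm_def)
  moreover have "K * sgrad_norm ?w ?q \<le> \<bar>K\<bar> * sgrad_norm ?w ?q"
    using y0 by (intro mult_right_mono) auto
  ultimately have d: "dt (density a c) ?q \<le> - 2 * (slap ?w ?q)\<^sup>2 / real CARD('n)
    + 2 * \<bar>K\<bar> * sgrad_norm ?w ?q - (p - 1) * ?v * density a c ?q
    + (a * (p - 1)\<^sup>2 + (a - 1) * (p - 1)) * (?v * sgrad_norm ?w ?q)"
    using evol by simp
  have "(density a c) differentiable (at ((y, 0) + t0 *\<^sub>R (0, 1)))"
    using csmooth_differentiable[OF csmooth_harnack_density[OF w] q] by simp
  from ddir_line[OF this]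
  have "((\<lambda>s. density a c (y, s)) has_real_derivative dt (density a c) ?q) (at t0)" by simp
  then have "((\<lambda>s. (s - e) * density a c (y, s)) has_real_derivative
      density a c ?q + (t0 - e) * dt (density a c) ?q) (at t0)"
    by (auto intro!: derivative_eq_intros)
  from DERIV_nonneg_left_max[OF this t(1)]
  have time: "0 \<le> density a c ?q + (t0 - e) * dt (density a c) ?q" using M[OF y] by simp
  have v: "?v \<le> B"
    using bound[of t0 x0] t0 u_pos[OF t0, of x0] x0 by (simp add: powr_def log_chart_def)
  show ?thesis
    unfolding Q0 harnack_bound_def
    by (rule harnack_algebra[OF _ a p _ _ _ v y0 _ time d]) (use t e in \<open>auto simp: harnack_density_def\<close>)
qed

text \<open>For fixed \<open>t\<close> the slab from time e to time \<open>t\<close> is compact, so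
  the weighted quantity attains a maximum, to which \<open>harnack_at_max\<close> applies. The bound
  is independent of e, and e tends to 0.\<close>

lemma harnack_quantity_le:
  assumes t: "t \<in> {0..<T}"
  shows "harnack_quantity A g T a p lam u x t \<le> harnack_bound"
proof (cases "t = 0")
  \<comment> \<open>The prefactor \<open>t\<close> makes the quantity 0 at the initial time.\<close>
  case True
  then show ?thesis using harnack_bound_nonneg by (simp add: harnack_quantity_def Let_def)
next
  case False
  then have t: "0 < t" "t < T" using t by auto
  define q where "q = harnack_quantity A g T a p lam u x t / t"
  have le: "(t - e) * q \<le> harnack_bound" if e: "0 < e" "e < t" for e
  proof -
    let ?F = "\<lambda>(x, t). (t - e) * (harnack_quantity A g T a p lam u x t / t)"
    have "compact ((UNIV :: 'm set) \<times> {e..t})" by (intro compact_Times compact_manifold compact_Icc)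
    moreover have "continuous_on (UNIV \<times> {e..t}) ?F"
      by (rule continuous_at_imp_continuous_on) (use e t in \<open>auto simp del: times_divide_eq_right intro!: continuous_harnack\<close>)
    moreover have "(UNIV :: 'm set) \<times> {e..t} \<noteq> {}" using e by auto
    ultimately obtain z where z: "z \<in> UNIV \<times> {e..t}" "\<forall>q\<in>UNIV \<times> {e..t}. ?F q \<le> ?F z"
      using continuous_attains_sup by blast
    obtain x0 t0 where zz: "z = (x0, t0)" by (cases z)
    have t0: "e \<le> t0" "t0 \<le> t" using z(1) zz by auto
    have max: "(s - e) * (harnack_quantity A g T a p lam u x s / s)
        \<le> (t0 - e) * (harnack_quantity A g T a p lam u x0 t0 / t0)" if "s \<in> {e..t}" for x s
      using bspec[OF z(2), of "(x, s)"] that by (simp add: zz)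
    have "(t0 - e) * (harnack_quantity A g T a p lam u x0 t0 / t0) \<le> harnack_bound"
    proof (cases "t0 = e")
      case True then show ?thesis using harnack_bound_nonneg by simp
    next
      case False
      show ?thesis
        by (rule harnack_at_max) (use False e t t0 max in auto)
    qed
    then show ?thesis using max[of t x] e unfolding q_def by simp
  qed
  have "t * q \<le> harnack_bound"
  proof (rule ccontr)
    assume gt: "\<not> ?thesis"
    then have "t * q > 0" using harnack_bound_nonneg by linarith
    then have q: "q > 0" using t by (simp add: zero_less_mult_iff)
    \<comment> \<open>With this \<open>e\<close> the number (t - e) q is the midpoint of t q and
      \<open>harnack_bound\<close>, hence above the bound.\<close>
    define e where "e = (t * q - harnack_bound) / (2 * q)"
    have "e > 0" using gt q by (simp add: e_def)
    moreover have "e < t" using harnack_bound_nonneg q t by (simp add: e_def divide_less_eq)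
      (smt (verit) mult_pos_pos)
    ultimately have "(t - e) * q \<le> harnack_bound" by (rule le)
    moreover have "e * q = (t * q - harnack_bound) / 2" using q by (simp add: e_def)
    ultimately have "t * q - (t * q - harnack_bound) / 2 \<le> harnack_bound"
      by (simp add: left_diff_distrib)
    then show False using gt by (simp add: field_simps)
  qed
  then show ?thesis using t by (simp add: q_def)
qed

end

text \<open>The supremum is taken in \<open>ereal\<close>, so its finiteness is part of the
  assertion. The constant found depends on the manifold only through its dimension.\<close>

theorem theorem8:
  fixes A :: "('m::{t2_space,second_countable_topology}, 'n::finite) chart set"
    and g :: "('m, 'n) chart \<Rightarrow> real^'n \<Rightarrow> real^'n^'n"
  assumes "closed_riemannian_manifold A g"
  shows "\<exists>C :: real \<Rightarrow> real \<Rightarrow> real \<Rightarrow> real \<Rightarrow> real \<Rightarrow> real.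
    \<forall>(B::real) (K::real) (a::real) (p::real) (T::real)
      (lam :: real \<Rightarrow> real) (u :: 'm \<Rightarrow> real \<Rightarrow> real).
      ricci_bounded_below A g (- K) \<longrightarrow> T > 0 \<longrightarrow> p > 1 \<longrightarrow> a > 1 \<longrightarrow>
      heat_solution A g T p lam u \<longrightarrow>
      (\<forall>x. \<forall>t\<in>{0..<T}. u x t powr (p - 1) \<le> B) \<longrightarrow>
      (SUP (x, t) \<in> UNIV \<times> {0..<T}. ereal (harnack_quantity A g T a p lam u x t))
        \<le> ereal (C B K a p T)"
proof -
  \<comment> \<open>\<open>harnack_bound\<close> with explicit parameters, as the constant has to be
    fixed before the solution and its bounds.\<close>
  define C where "C B K a p T = real CARD('n) * a\<^sup>2 / 2 + T\<^sup>2 * (real CARD('n) * a\<^sup>2 *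
     (2 * \<bar>K\<bar> + (a * (p - 1)\<^sup>2 + (a - 1) * (p - 1)) * B)\<^sup>2 / (8 * (a - 1)\<^sup>2))" for B K a p T :: real
  interpret closed_riemannian_manifold A g by (rule assms)
  have "(SUP (x, t) \<in> UNIV \<times> {0..<T}. ereal (harnack_quantity A g T a p lam u x t)) \<le> ereal (C B K a p T)"
    if "ricci_bounded_below A g (- K)" "p > 1" "a > 1" "heat_solution A g T p lam u"
      "\<forall>x. \<forall>t\<in>{0..<T}. u x t powr (p - 1) \<le> B" for B K a p T lam u
  proof -
    interpret compact_heat_flow A g T p lam u a B K
      by unfold_locales (use that in auto)
    have "C B K a p T = harnack_bound" by (simp add: C_def harnack_bound_def)
    then show ?thesis by (auto intro!: SUP_least harnack_quantity_le)
  qed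
  then show ?thesis by (intro exI[of _ C]) blast
qed

end
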